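(* Let $A$ be a commutative ring, $n\ge1$ an integer, $S$ an index set with a distinguished element $s_1$, and $A[Y]$ the polynomial ring over $A$ in independent variables $Y_s$, $s\in S$; write $Y_1=Y_{s_1}$. Let $F$ be the free $A$-module with basis $e=T_1,\dots,T_n$ and let $\beta_1:F\to A[Y]$ be the $A$-module homomorphism with $\beta_1(T_i)=Y_1^{i-1}$ for $i=1,\dots,n$. Then $H^{\beta_1}_{A[Y]}$ is the polynomial ring over $A$ in the independent variables (the classes of) $U^{s_1}_{1n},\dots,U^{s_1}_{nn}$ and $U^s_{11},\dots,U^s_{n1}$ for all $s\in S$ different from $s_1$. The universal family is given by the ideal in $A[Y]\otimes_AH^{\beta_1}_{A[Y]}$ generated by the elements $$Y_1^n-U^{s_1}_{1n}-U^{s_1}_{2n}Y_1-\cdots-U^{s_1}_{nn}Y_1^{n-1}$$ and $$Y_s-U^s_{11}-U^s_{21}Y_1-\cdots-U^s_{n1}Y_1^{n-1}\quad\text{for } s\in S\setminus\{s_1\}.$$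
   Context: Let $A[U]$ be the polynomial ring over $A$ in independent variables $U^s_{ij}$, $s\in S$, $i,j=1,\dots,n$, and let $(U^s_{ij})$ denote the $n\times n$ matrix over $A[U]$ with these entries, acting on $A[U]\otimes_AF$ by $T_j\mapsto\sum_iU^s_{ij}T_i$. The ring $H^{\beta_1}_{A[Y]}$ is the quotient of $A[U]$ by the ideal generated by: (i) all entries of the commutators $(U^s_{ij})(U^t_{ij})-(U^t_{ij})(U^s_{ij})$, $s,t\in S$; and (ii) the coefficients of $T_1,\dots,T_n$ in $(U^{s_1}_{ij})^{k-1}T_1-T_k$, for $k=1,\dots,n$. It represents the functor that sends a commutative $A$-algebra $B$ to the set of ideals $J\subseteq B\otimes_AA[Y]$ such that the composite $B\otimes_AF\xrightarrow{\operatorname{id}_B\otimes\beta_1}B\otimes_AA[Y]\to(B\otimes_AA[Y])/J$ is an isomorphism of $B$-modules. The universal family is the kernel of the universal homomorphism $H^{\beta_1}_{A[Y]}\otimes_AA[Y]\to H^{\beta_1}_{A[Y]}\otimes_AF$, $1\otimes f(Y)\mapsto f((U^s_{ij}))T_1$, where $f((U^s_{ij}))$ is obtained by substituting the (commuting) matrices $(U^s_{ij})$ for the variables $Y_s$. *)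

theory Defs
  imports "HOL-Algebra.Indexed_Polynomials"
begin

text \<open>
  Polynomials over a ring record in variables indexed by a set, in the representation of
  \<^theory>\<open>HOL-Algebra.Indexed_Polynomials\<close>: a monomial is a multiset of variables, and a
  polynomial maps monomials to coefficients. For \<open>W \<subseteq> V\<close> the polynomial ring
  in \<open>W\<close> is literally a subring of the one in \<open>V\<close>.
\<close>

definition indexed_poly_ring :: "('a, 'm) ring_scheme \<Rightarrow> 'v set \<Rightarrow> ('v multiset \<Rightarrow> 'a) ring"
  where "indexed_poly_ring R V =
    \<lparr> carrier = ring.indexed_pset R V (carrier R),
      monoid.mult = (\<lambda>p q m. \<Oplus>\<^bsub>R\<^esub>k \<in> {k. k \<subseteq># m}. p k \<otimes>\<^bsub>R\<^esub> q (m - k)),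
      one = ring.indexed_const R \<one>\<^bsub>R\<^esub>,
      zero = ring.indexed_const R \<zero>\<^bsub>R\<^esub>,
      add = ring.indexed_padd R \<rparr>"

text \<open>
  Vectors and \<open>n \<times> n\<close> matrices over a ring record are functions of indices in \<open>{1..n}\<close>;
  values at other indices carry no meaning and are never used. The vector \<open>v\<close> stands for
  the element \<open>\<Sum>i. v i T\<^sub>i\<close> of the free module with basis \<open>T\<^sub>1, \<dots>, T\<^sub>n\<close>, and the matrix
  \<open>M\<close> for the endomorphism sending \<open>T\<^sub>j\<close> to \<open>\<Sum>i. M i j T\<^sub>i\<close>.
\<close>

definition basis_vec :: "('a, 'm) ring_scheme \<Rightarrow> nat \<Rightarrow> nat \<Rightarrow> 'a"
  where "basis_vec R k = (\<lambda>i. if i = k then \<one>\<^bsub>R\<^esub> else \<zero>\<^bsub>R\<^esub>)"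

definition mat_act :: "('a, 'm) ring_scheme \<Rightarrow> nat \<Rightarrow> (nat \<Rightarrow> nat \<Rightarrow> 'a) \<Rightarrow> (nat \<Rightarrow> 'a) \<Rightarrow> nat \<Rightarrow> 'a"
  where "mat_act R n M v = (\<lambda>i. \<Oplus>\<^bsub>R\<^esub>j \<in> {1..n}. M i j \<otimes>\<^bsub>R\<^esub> v j)"

definition mat_one :: "('a, 'm) ring_scheme \<Rightarrow> nat \<Rightarrow> nat \<Rightarrow> 'a"
  where "mat_one R = (\<lambda>i j. if i = j then \<one>\<^bsub>R\<^esub> else \<zero>\<^bsub>R\<^esub>)"

definition mat_mult ::
    "('a, 'm) ring_scheme \<Rightarrow> nat \<Rightarrow> (nat \<Rightarrow> nat \<Rightarrow> 'a) \<Rightarrow> (nat \<Rightarrow> nat \<Rightarrow> 'a) \<Rightarrow> nat \<Rightarrow> nat \<Rightarrow> 'a"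
  where "mat_mult R n M N = (\<lambda>i j. \<Oplus>\<^bsub>R\<^esub>k \<in> {1..n}. M i k \<otimes>\<^bsub>R\<^esub> N k j)"

definition mat_pow :: "('a, 'm) ring_scheme \<Rightarrow> nat \<Rightarrow> (nat \<Rightarrow> nat \<Rightarrow> 'a) \<Rightarrow> nat \<Rightarrow> nat \<Rightarrow> nat \<Rightarrow> 'a"
  where "mat_pow R n M k = (mat_mult R n M ^^ k) (mat_one R)"

text \<open>
  Substitution of matrices \<open>M s\<close> for the variables. The factors of a monomial are multiplied
  in an arbitrarily chosen order; this is only used for commuting matrices, where the order
  is immaterial.
\<close>

definition mat_monomial ::
    "('a, 'm) ring_scheme \<Rightarrow> nat \<Rightarrow> ('s \<Rightarrow> nat \<Rightarrow> nat \<Rightarrow> 'a) \<Rightarrow> 's multiset \<Rightarrow> nat \<Rightarrow> nat \<Rightarrow> 'a"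
  where "mat_monomial R n M m =
    foldr (\<lambda>s. mat_mult R n (M s)) (SOME xs. mset xs = m) (mat_one R)"

definition mat_poly ::
    "('a, 'm) ring_scheme \<Rightarrow> nat \<Rightarrow> ('s \<Rightarrow> nat \<Rightarrow> nat \<Rightarrow> 'a) \<Rightarrow> ('s multiset \<Rightarrow> 'a) \<Rightarrow> nat \<Rightarrow> nat \<Rightarrow> 'a"
  where "mat_poly R n M f =
    (\<lambda>i j. \<Oplus>\<^bsub>R\<^esub>m \<in> {m. f m \<noteq> \<zero>\<^bsub>R\<^esub>}. f m \<otimes>\<^bsub>R\<^esub> mat_monomial R n M m i j)"

text \<open>The triple \<open>(s, i, j)\<close> is the index of the variable \<open>U\<^sup>s\<^sub>i\<^sub>j\<close>.\<close>

definition U_ring ::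
    "('a, 'm) ring_scheme \<Rightarrow> nat \<Rightarrow> 's set \<Rightarrow> (('s \<times> nat \<times> nat) multiset \<Rightarrow> 'a) ring"
  where "U_ring A n S = indexed_poly_ring A (S \<times> {1..n} \<times> {1..n})"

definition U_mat ::
    "('a, 'm) ring_scheme \<Rightarrow> 's \<Rightarrow> nat \<Rightarrow> nat \<Rightarrow> ('s \<times> nat \<times> nat) multiset \<Rightarrow> 'a"
  where "U_mat A s = (\<lambda>i j. ring.indexed_var A (s, i, j))"

definition commutator_relations ::
    "('a, 'm) ring_scheme \<Rightarrow> nat \<Rightarrow> 's set \<Rightarrow> (('s \<times> nat \<times> nat) multiset \<Rightarrow> 'a) set"
  where "commutator_relations A n S =
    {mat_mult (U_ring A n S) n (U_mat A s) (U_mat A t) i j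
       \<ominus>\<^bsub>U_ring A n S\<^esub> mat_mult (U_ring A n S) n (U_mat A t) (U_mat A s) i j
     | s t i j. s \<in> S \<and> t \<in> S \<and> i \<in> {1..n} \<and> j \<in> {1..n}}"

text \<open>
  The coefficients of \<open>(U\<^sup>s\<^sup>1)\<^sup>k\<^sup>-\<^sup>1 T\<^sub>1 - T\<^sub>k\<close>. Here \<open>(U\<^sup>s\<^sup>1)\<^sup>k\<^sup>-\<^sup>1\<close> is the polynomial
  \<open>\<beta>\<^sub>1(T\<^sub>k) = Y\<^sub>1\<^sup>k\<^sup>-\<^sup>1\<close> evaluated at the generic matrices; this is how \<open>\<beta>\<^sub>1\<close> enters.
\<close>

definition basis_relations ::
    "('a, 'm) ring_scheme \<Rightarrow> nat \<Rightarrow> 's set \<Rightarrow> 's \<Rightarrow> (('s \<times> nat \<times> nat) multiset \<Rightarrow> 'a) set"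
  where "basis_relations A n S s1 =
    {mat_act (U_ring A n S) n (mat_pow (U_ring A n S) n (U_mat A s1) (k - 1))
         (basis_vec (U_ring A n S) 1) i
       \<ominus>\<^bsub>U_ring A n S\<^esub> basis_vec (U_ring A n S) k i
     | k i. k \<in> {1..n} \<and> i \<in> {1..n}}"

definition H_ideal ::
    "('a, 'm) ring_scheme \<Rightarrow> nat \<Rightarrow> 's set \<Rightarrow> 's \<Rightarrow> (('s \<times> nat \<times> nat) multiset \<Rightarrow> 'a) set"
  where "H_ideal A n S s1 =
    Idl\<^bsub>U_ring A n S\<^esub> (commutator_relations A n S \<union> basis_relations A n S s1)"

definition H_ring ::
    "('a, 'm) ring_scheme \<Rightarrow> nat \<Rightarrow> 's set \<Rightarrow> 's \<Rightarrow> (('s \<times> nat \<times> nat) multiset \<Rightarrow> 'a) set ring"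
  where "H_ring A n S s1 = U_ring A n S Quot H_ideal A n S s1"

definition H_class ::
    "('a, 'm) ring_scheme \<Rightarrow> nat \<Rightarrow> 's set \<Rightarrow> 's \<Rightarrow>
      (('s \<times> nat \<times> nat) multiset \<Rightarrow> 'a) \<Rightarrow> (('s \<times> nat \<times> nat) multiset \<Rightarrow> 'a) set"
  where "H_class A n S s1 p = H_ideal A n S s1 +>\<^bsub>U_ring A n S\<^esub> p"

definition H_mat ::
    "('a, 'm) ring_scheme \<Rightarrow> nat \<Rightarrow> 's set \<Rightarrow> 's \<Rightarrow>
      's \<Rightarrow> nat \<Rightarrow> nat \<Rightarrow> (('s \<times> nat \<times> nat) multiset \<Rightarrow> 'a) set"
  where "H_mat A n S s1 s = (\<lambda>i j. H_class A n S s1 (U_mat A s i j))"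

text \<open>
  The base change \<open>A[Y] \<otimes>\<^sub>A H\<close> is taken in its standard form \<open>H[Y]\<close>, with \<open>f \<otimes> h\<close>
  corresponding to \<open>h f\<close> for \<open>f\<close> in \<open>A[Y]\<close> and \<open>h\<close> in \<open>H\<close>; likewise \<open>H \<otimes>\<^sub>A F\<close> is
  \<open>H\<^sup>n\<close>. The universal homomorphism is the \<open>H\<close>-linear extension of
  \<open>1 \<otimes> f \<mapsto> f(U) T\<^sub>1\<close>, i.e. the coefficients of \<open>f\<close> now lie in \<open>H\<close>.
\<close>

definition HY_ring ::
    "('a, 'm) ring_scheme \<Rightarrow> nat \<Rightarrow> 's set \<Rightarrow> 's \<Rightarrow>
      ('s multiset \<Rightarrow> (('s \<times> nat \<times> nat) multiset \<Rightarrow> 'a) set) ring"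
  where "HY_ring A n S s1 = indexed_poly_ring (H_ring A n S s1) S"

definition universal_hom ::
    "('a, 'm) ring_scheme \<Rightarrow> nat \<Rightarrow> 's set \<Rightarrow> 's \<Rightarrow>
      ('s multiset \<Rightarrow> (('s \<times> nat \<times> nat) multiset \<Rightarrow> 'a) set) \<Rightarrow>
      nat \<Rightarrow> (('s \<times> nat \<times> nat) multiset \<Rightarrow> 'a) set"
  where "universal_hom A n S s1 f =
    mat_act (H_ring A n S s1) n (mat_poly (H_ring A n S s1) n (H_mat A n S s1) f)
      (basis_vec (H_ring A n S s1) 1)"

definition universal_family ::
    "('a, 'm) ring_scheme \<Rightarrow> nat \<Rightarrow> 's set \<Rightarrow> 's \<Rightarrow>
      ('s multiset \<Rightarrow> (('s \<times> nat \<times> nat) multiset \<Rightarrow> 'a) set) set"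
  where "universal_family A n S s1 =
    {f \<in> carrier (HY_ring A n S s1).
       \<forall>i \<in> {1..n}. universal_hom A n S s1 f i = \<zero>\<^bsub>H_ring A n S s1\<^esub>}"

definition Y_var ::
    "('a, 'm) ring_scheme \<Rightarrow> nat \<Rightarrow> 's set \<Rightarrow> 's \<Rightarrow>
      's \<Rightarrow> 's multiset \<Rightarrow> (('s \<times> nat \<times> nat) multiset \<Rightarrow> 'a) set"
  where "Y_var A n S s1 s = ring.indexed_var (H_ring A n S s1) s"

text \<open>The element \<open>U\<^sup>s\<^sub>1\<^sub>j + U\<^sup>s\<^sub>2\<^sub>j Y\<^sub>1 + \<dots> + U\<^sup>s\<^sub>n\<^sub>j Y\<^sub>1\<^sup>n\<^sup>-\<^sup>1\<close> of \<open>H[Y]\<close>.\<close>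

definition column_poly ::
    "('a, 'm) ring_scheme \<Rightarrow> nat \<Rightarrow> 's set \<Rightarrow> 's \<Rightarrow>
      's \<Rightarrow> nat \<Rightarrow> 's multiset \<Rightarrow> (('s \<times> nat \<times> nat) multiset \<Rightarrow> 'a) set"
  where "column_poly A n S s1 s j =
    (\<Oplus>\<^bsub>HY_ring A n S s1\<^esub>i \<in> {1..n}.
       ring.indexed_const (H_ring A n S s1) (H_mat A n S s1 s i j)
         \<otimes>\<^bsub>HY_ring A n S s1\<^esub> (Y_var A n S s1 s1 [^]\<^bsub>HY_ring A n S s1\<^esub> (i - 1)))"

end

theory Submission
  imports Defs
begin

text \<open>
  Modulo the relations, \<open>U\<^sup>s\<^sup>1\<close> sends \<open>T\<^sub>j\<close> to \<open>T\<^sub>j\<^sub>+\<^sub>1\<close> for \<open>j < n\<close>, so it is the companion matrix of its last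
  column; and since \<open>U\<^sup>s\<close> commutes with it and \<open>T\<^sub>1\<close> is cyclic, \<open>U\<^sup>s\<close> is the polynomial in
  \<open>U\<^sup>s\<^sup>1\<close> whose coefficients are the first column of \<open>U\<^sup>s\<close>. Hence the listed variables generate the
  quotient. Conversely, over the polynomial ring in the listed variables the generic companion
  matrix and the generic polynomials in it satisfy all the relations, and this gives a
  retraction of \<open>A[U]\<close> onto that ring which kills the ideal; so there are no further relations.

  The kernel of the universal homomorphism contains the displayed generators. Modulo these every
  element of \<open>H[Y]\<close> is a combination of \<open>1, Y\<^sub>1, \<dots>, Y\<^sub>1\<^sup>n\<^sup>-\<^sup>1\<close>, and the universal homomorphism
  sends such a combination to its vector of coefficients.
\<close>

section \<open>Polynomial rings in indexed variables\<close>

text \<open>The argument hinges on one notion, \<open>cyclic_matrices\<close>: commuting matrices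
  such that the powers of \<open>M s1\<close> carry T_1 to T_1, ..., T_n. A homomorphism out of
  \<open>U_ring\<close> kills the relations exactly when the images of the generic matrices form
  such a family, so the ideal never has to be described by its elements. One direction of this
  equivalence is used over the quotient, to generate all entries; the other over the polynomial ring
  in the listed variables, to see that the retraction kills the ideal. A retraction can stand in for
  an inverse map because the smaller polynomial ring is a subring of A[U] and the isomorphism is the
  class map itself. Two features of the encoding shape the rest. Matrices have meaningless entries
  outside {1..n}, so commutation is stated for operators on extensional vectors and not as an
  equality of functions. Monomials in matrices are formed in a chosen order, so multiplication of
  polynomials is tested one variable at a time, by induction on a factor.\<close>

definition (in ring) indexed_times :: "('c multiset \<Rightarrow> 'a) \<Rightarrow> ('c multiset \<Rightarrow> 'a) \<Rightarrow> 'c multiset \<Rightarrow> 'a"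
  where "indexed_times p q = (\<lambda>m. \<Oplus>k \<in> {k. k \<subseteq># m}. p k \<otimes> q (m - k))"

lemma (in ring) indexed_poly_ring_simps:
  "carrier (indexed_poly_ring R V) = indexed_pset V (carrier R)"
  "p \<otimes>\<^bsub>indexed_poly_ring R V\<^esub> q = indexed_times p q"
  "\<one>\<^bsub>indexed_poly_ring R V\<^esub> = indexed_const \<one>"
  "\<zero>\<^bsub>indexed_poly_ring R V\<^esub> = indexed_const \<zero>"
  "p \<oplus>\<^bsub>indexed_poly_ring R V\<^esub> q = indexed_padd p q"
  by (simp_all add: indexed_poly_ring_def indexed_times_def)

text \<open>Convolution sums range over submultisets, and \<open>\<Oplus>\<close> over an infinite
  set is zero by convention, so finiteness is what gives these sums content. A submultiset of
  \<open>add_mset x m\<close> either misses x and lies in m, or is \<open>add_mset x\<close> of a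
  submultiset of m.\<close>

lemma finite_submultisets [simp]: "finite {k. k \<subseteq># m}"
proof (induction m)
  case (add x m)
  have "{k. k \<subseteq># add_mset x m} \<subseteq> {k. k \<subseteq># m} \<union> add_mset x ` {k. k \<subseteq># m}"
  proof
    fix k assume "k \<in> {k. k \<subseteq># add_mset x m}"
    then have k: "k \<subseteq># add_mset x m" by simp
    show "k \<in> {k. k \<subseteq># m} \<union> add_mset x ` {k. k \<subseteq># m}"
    proof (cases "x \<in># k")
      case True
      then obtain k' where "k = add_mset x k'" by (metis insert_DiffM)
      with k show ?thesis by simp
    next
      case False
      have "k - {#x#} \<subseteq># m"
        using k by (simp add: subset_eq_diff_conv)
      with False show ?thesis by (simp add: diff_single_trivial)
    qed
  qed
  then show ?case
    by (rule finite_subset) (use add in auto)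
qed simp

lemma diff_diff_submultiset: "k \<subseteq># m \<Longrightarrow> m - (m - k) = k"
  by (auto simp: multiset_eq_iff subseteq_mset_def)

section \<open>Convolution of polynomials\<close>

context ring
begin

lemma carrier_coeff_pset:
  "p \<in> indexed_pset V (carrier R) \<Longrightarrow> carrier_coeff p"
  by (rule indexed_pset_in_carrier) auto

lemma carrier_coeff_const [simp, intro]: "k \<in> carrier R \<Longrightarrow> carrier_coeff (indexed_const k)"
  by (auto simp: carrier_coeff_def indexed_const_def)

lemma indexed_times_closed_coeff:
  assumes "carrier_coeff p" "carrier_coeff q"
  shows "carrier_coeff (indexed_times p q)"
  using assms unfolding carrier_coeff_def indexed_times_def by (auto intro!: finsum_closed)

text \<open>\<open>indexed_pset\<close> is generated from constants by sums and by multiplication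
  with a variable. This rule and its companions for constants and variables compute a convolution
  along these three cases, so later facts about products follow by induction on the left
  factor.\<close>

lemma indexed_times_padd_left:
  assumes "carrier_coeff p" "carrier_coeff q" "carrier_coeff r"
  shows "indexed_times (indexed_padd p q) r = indexed_padd (indexed_times p r) (indexed_times q r)"
proof
  fix m
  show "indexed_times (indexed_padd p q) r m = indexed_padd (indexed_times p r) (indexed_times q r) m"
    using assms unfolding indexed_times_def indexed_padd_def carrier_coeff_def
    by (subst finsum_addf[symmetric]) (auto simp: l_distr intro!: finsum_cong')
qed

lemma indexed_times_const_left:
  assumes "k \<in> carrier R" "carrier_coeff q"
  shows "indexed_times (indexed_const k) q = (\<lambda>m. k \<otimes> q m)"
proof
  fix m
  have "indexed_times (indexed_const k) q m = (\<Oplus>j \<in> {{#}}. k \<otimes> q (m - j))"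
    unfolding indexed_times_def
    by (rule add.finprod_mono_neutral_cong_right)
       (use assms in \<open>auto simp: carrier_coeff_def indexed_const_def\<close>)
  then show "indexed_times (indexed_const k) q m = k \<otimes> q m"
    using assms by (simp add: carrier_coeff_def)
qed

text \<open>Summands with i not in k vanish on the left, and the submultisets of
  \<open>add_mset i m'\<close> that contain i are those of m' with i added; reindexing by
  \<open>add_mset i\<close> gives the shifted convolution.\<close>

lemma indexed_times_pmult_left:
  assumes "carrier_coeff p" "carrier_coeff q"
  shows "indexed_times (indexed_pmult p i) q = indexed_pmult (indexed_times p q) i"
proof
  fix m
  show "indexed_times (indexed_pmult p i) q m = indexed_pmult (indexed_times p q) i m"
  proof (cases "i \<in># m")
    case False
    then have "k \<subseteq># m \<Longrightarrow> i \<notin># k" for k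
      by (auto dest: mset_subset_eqD)
    with False assms show ?thesis
      by (auto simp: indexed_times_def indexed_pmult_def carrier_coeff_def intro!: add.finprod_one_eqI)
  next
    case True
    then obtain m' where m: "m = add_mset i m'" by (metis insert_DiffM)
    have img: "add_mset i ` {k. k \<subseteq># m'} \<subseteq> {k. k \<subseteq># m}"
      by (auto simp: m)
    have out: "i \<notin># k" if "k \<in> {k. k \<subseteq># m} - add_mset i ` {k. k \<subseteq># m'}" for k
    proof
      assume "i \<in># k"
      then obtain k' where "k = add_mset i k'" by (metis insert_DiffM)
      with that show False by (auto simp: m)
    qed
    have "indexed_times (indexed_pmult p i) q m
        = (\<Oplus>k \<in> add_mset i ` {k. k \<subseteq># m'}. indexed_pmult p i k \<otimes> q (m - k))"
      unfolding indexed_times_def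
      by (rule add.finprod_mono_neutral_cong_right)
         (use assms img out in \<open>auto simp: carrier_coeff_def indexed_pmult_def\<close>)
    also have "\<dots> = (\<Oplus>k \<in> {k. k \<subseteq># m'}. indexed_pmult p i (add_mset i k) \<otimes> q (m - add_mset i k))"
      by (rule finsum_reindex)
         (use assms in \<open>auto simp: carrier_coeff_def indexed_pmult_def inj_on_def\<close>)
    also have "\<dots> = indexed_pmult (indexed_times p q) i m"
      using assms
      by (auto simp: m indexed_pmult_def indexed_times_def carrier_coeff_def intro!: finsum_cong')
    finally show ?thesis .
  qed
qed

lemma indexed_pset_scale:
  fixes V :: "'c set"
  assumes "p \<in> indexed_pset V (carrier R)" "k \<in> carrier R"
  shows "(\<lambda>m. k \<otimes> p m) \<in> indexed_pset V (carrier R)"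
  using assms(1)
proof induction
  case (indexed_const c)
  have "(\<lambda>m :: 'c multiset. k \<otimes> indexed_const c m) = indexed_const (k \<otimes> c)"
    using assms indexed_const by (auto simp: indexed_const_def)
  moreover have "indexed_const (k \<otimes> c) \<in> indexed_pset V (carrier R)"
    using assms indexed_const by (intro indexed_pset.indexed_const) auto
  ultimately show ?case by simp
next
  case (indexed_padd p q)
  have "(\<lambda>m. k \<otimes> indexed_padd p q m) = indexed_padd (\<lambda>m. k \<otimes> p m) (\<lambda>m. k \<otimes> q m)"
    using assms indexed_padd.hyps[THEN carrier_coeff_pset]
    by (auto simp: indexed_padd_def r_distr carrier_coeff_def)
  then show ?case
    using indexed_padd by (auto intro: indexed_pset.indexed_padd)
next
  case (indexed_pmult p i)
  have "(\<lambda>m. k \<otimes> indexed_pmult p i m) = indexed_pmult (\<lambda>m. k \<otimes> p m) i"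
    using assms by (auto simp: indexed_pmult_def)
  then show ?case
    using indexed_pmult by (auto intro: indexed_pset.indexed_pmult)
qed

lemma indexed_times_closed:
  assumes "p \<in> indexed_pset V (carrier R)" "q \<in> indexed_pset V (carrier R)"
  shows "indexed_times p q \<in> indexed_pset V (carrier R)"
  using assms(1)
proof induction
  case (indexed_const k)
  then show ?case
    using assms(2) by (simp add: indexed_times_const_left carrier_coeff_pset indexed_pset_scale)
next
  case (indexed_padd p p')
  then show ?case
    using assms(2)
    by (simp add: indexed_times_padd_left carrier_coeff_pset indexed_pset.indexed_padd)
next
  case (indexed_pmult p i)
  then show ?case
    using assms(2)
    by (simp add: indexed_times_pmult_left carrier_coeff_pset indexed_pset.indexed_pmult)
qed

lemma indexed_times_scale_left:
  assumes "k \<in> carrier R" "carrier_coeff p" "carrier_coeff q"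
  shows "indexed_times (\<lambda>m. k \<otimes> p m) q = (\<lambda>m. k \<otimes> indexed_times p q m)"
  using assms unfolding indexed_times_def carrier_coeff_def
  by (auto simp: finsum_rdistr m_assoc intro!: ext finsum_cong')

text \<open>Induction on the left factor replaces the rearrangement of a triple sum by the rules for
  constants, sums and variables.\<close>

lemma indexed_times_assoc:
  assumes "p \<in> indexed_pset V (carrier R)" "carrier_coeff q" "carrier_coeff r"
  shows "indexed_times (indexed_times p q) r = indexed_times p (indexed_times q r)"
  using assms(1)
proof induction
  case (indexed_const k)
  then show ?case
    using assms
    by (simp add: indexed_times_const_left indexed_times_closed_coeff indexed_times_scale_left)
next
  case (indexed_padd p p')
  then show ?case
    using assms by (simp add: indexed_times_padd_left carrier_coeff_pset indexed_times_closed_coeff)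
next
  case (indexed_pmult p i)
  then show ?case
    using assms by (simp add: indexed_times_pmult_left carrier_coeff_pset indexed_times_closed_coeff)
qed

text \<open>Connects the inductive set with the functional view: finite support makes sums over
  monomials meaningful, and only monomials in V have to be given values.\<close>

lemma indexed_pset_support:
  assumes "p \<in> indexed_pset V (carrier R)"
  shows "finite {m. p m \<noteq> \<zero>}" and "p m \<noteq> \<zero> \<Longrightarrow> set_mset m \<subseteq> V"
proof -
  have "finite {m. p m \<noteq> \<zero>} \<and> (\<forall>m. p m \<noteq> \<zero> \<longrightarrow> set_mset m \<subseteq> V)"
    using assms
  proof induction
    case (indexed_const k)
    have "{m. indexed_const k m \<noteq> \<zero>} \<subseteq> {{#}}"
      by (auto simp: indexed_const_def)
    then show ?case
      by (auto simp: indexed_const_def finite_subset split: if_splits)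
  next
    case (indexed_padd p q)
    then have "{m. indexed_padd p q m \<noteq> \<zero>} \<subseteq> {m. p m \<noteq> \<zero>} \<union> {m. q m \<noteq> \<zero>}"
      by (auto simp: indexed_padd_def)
    with indexed_padd show ?case
      by (auto intro: finite_subset)
  next
    case (indexed_pmult p i)
    have sub: "{m. indexed_pmult p i m \<noteq> \<zero>} \<subseteq> add_mset i ` {m. p m \<noteq> \<zero>}"
      by (force simp: indexed_pmult_def image_iff split: if_splits)
    show ?case
    proof (intro conjI allI impI)
      show "finite {m. indexed_pmult p i m \<noteq> \<zero>}"
        using sub indexed_pmult by (auto intro: finite_subset)
      show "set_mset m \<subseteq> V" if "indexed_pmult p i m \<noteq> \<zero>" for m
        using that sub indexed_pmult by fastforce
    qed
  qed
  then show "finite {m. p m \<noteq> \<zero>}" and "p m \<noteq> \<zero> \<Longrightarrow> set_mset m \<subseteq> V"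
    by auto
qed

lemma indexed_var_closed: "i \<in> V \<Longrightarrow> indexed_var i \<in> indexed_pset V (carrier R)"
  unfolding indexed_var_def
  by (intro indexed_pset.indexed_pmult indexed_pset.indexed_const) auto

end

section \<open>The commutative polynomial ring\<close>

context cring
begin

lemma indexed_times_comm:
  fixes p q :: "'c multiset \<Rightarrow> 'a"
  assumes "carrier_coeff p" "carrier_coeff q"
  shows "indexed_times p q = indexed_times q p"
proof
  fix m :: "'c multiset"
  \<comment> \<open>Taking complements in m is an involution on its submultisets, and reindexing by
    it swaps the two factors.\<close>
  have img: "(\<lambda>k. m - k) ` {k. k \<subseteq># m} = {k. k \<subseteq># m}"
  proof
    show "{k. k \<subseteq># m} \<subseteq> (\<lambda>k. m - k) ` {k. k \<subseteq># m}"
      by (rule subsetI, rule_tac x = "m - x" in image_eqI) (auto simp: diff_diff_submultiset)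
  qed auto
  have "indexed_times p q m = (\<Oplus>k \<in> (\<lambda>k. m - k) ` {k. k \<subseteq># m}. p k \<otimes> q (m - k))"
    by (simp add: indexed_times_def img)
  also have "\<dots> = (\<Oplus>k \<in> {k. k \<subseteq># m}. p (m - k) \<otimes> q (m - (m - k)))"
  proof (rule finsum_reindex)
    show "inj_on (\<lambda>k. m - k) {k. k \<subseteq># m}"
      by (rule inj_on_inverseI[of _ "\<lambda>k. m - k"]) (auto simp: multiset_eq_iff subseteq_mset_def)
  qed (use assms in \<open>auto simp: carrier_coeff_def\<close>)
  also have "\<dots> = indexed_times q p m"
    using assms unfolding indexed_times_def carrier_coeff_def
    by (intro finsum_cong') (auto simp: m_comm diff_diff_submultiset)
  finally show "indexed_times p q m = indexed_times q p m" .
qed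

lemma cring_indexed_poly_ring: "cring (indexed_poly_ring R V)"
proof (rule cringI)
  show "abelian_group (indexed_poly_ring R V)"
  proof (rule abelian_groupI)
    fix p assume p: "p \<in> carrier (indexed_poly_ring R V)"
    \<comment> \<open>The additive inverse is obtained by scaling with
      \<open>\<ominus> \<one>\<close>, because \<open>indexed_pset\<close> is already known to be
      closed under scaling.\<close>
    have "indexed_padd (\<lambda>m. \<ominus> \<one> \<otimes> p m) p = indexed_const \<zero>"
      using carrier_coeff_pset[of p V] p[unfolded indexed_poly_ring_simps]
      by (auto simp: indexed_padd_def indexed_zero_def carrier_coeff_def l_minus l_neg intro!: ext)
    then show "\<exists>q \<in> carrier (indexed_poly_ring R V).
        q \<oplus>\<^bsub>indexed_poly_ring R V\<^esub> p = \<zero>\<^bsub>indexed_poly_ring R V\<^esub>"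
      using p indexed_pset_scale[of p V "\<ominus> \<one>"] by (auto simp: indexed_poly_ring_simps)
  qed (auto simp: indexed_padd_zero carrier_coeff_pset simp: indexed_poly_ring_simps intro: indexed_pset.intros,
       auto simp: indexed_poly_ring_simps indexed_padd_def a_assoc a_comm dest!: carrier_coeff_pset
         intro!: ext a_assoc a_comm simp: carrier_coeff_def)
  show "comm_monoid (indexed_poly_ring R V)"
  proof (rule comm_monoidI)
    fix p assume p: "p \<in> carrier (indexed_poly_ring R V)"
    then show "\<one>\<^bsub>indexed_poly_ring R V\<^esub> \<otimes>\<^bsub>indexed_poly_ring R V\<^esub> p = p"
      using carrier_coeff_pset[of p V] by (auto simp: indexed_poly_ring_simps indexed_times_const_left carrier_coeff_def)
  qed (auto simp: indexed_poly_ring_simps indexed_times_closed indexed_times_assoc carrier_coeff_pset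
        intro: indexed_pset.intros indexed_times_comm)
qed (auto simp: indexed_poly_ring_simps indexed_times_padd_left carrier_coeff_pset)

lemma indexed_times_var:
  assumes "carrier_coeff p"
  shows "indexed_times p (indexed_var i) = indexed_pmult p i"
proof -
  have "carrier_coeff (indexed_var i)"
    unfolding indexed_var_def by (intro indexed_pmult_in_carrier carrier_coeff_const) simp
  then have "indexed_times p (indexed_var i) = indexed_times (indexed_var i) p"
    using assms by (rule indexed_times_comm[rotated])
  also have "\<dots> = indexed_pmult (indexed_times (indexed_const \<one>) p) i"
    unfolding indexed_var_def using assms by (simp add: indexed_times_pmult_left)
  also have "\<dots> = indexed_pmult p i"
    using assms by (simp add: indexed_times_const_left carrier_coeff_def)
  finally show ?thesis .
qed

end

section \<open>Evaluation of polynomials\<close>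

text \<open>The choice \<open>SOME xs. mset xs = m\<close> is the one made in
  \<open>mat_monomial\<close>, so the two can be compared on the same list.\<close>

definition foldr_mset :: "('i \<Rightarrow> 'v \<Rightarrow> 'v) \<Rightarrow> 'i multiset \<Rightarrow> 'v \<Rightarrow> 'v"
  where "foldr_mset T m v = foldr T (SOME xs. mset xs = m) v"

lemma foldr_mset_empty [simp]: "foldr_mset T {#} v = v"
  by (simp add: foldr_mset_def)

text \<open>Used for multiplications by elements of a commutative ring, where it yields evaluation
  homomorphisms, and for commuting matrices acting on vectors. Commutation is asked for on
  \<open>E\<close> because functions outside the carrier carry no information.\<close>

locale commuting_operators =
  fixes I :: "'i set" and E :: "'v set" and T :: "'i \<Rightarrow> 'v \<Rightarrow> 'v"
  assumes closed: "s \<in> I \<Longrightarrow> v \<in> E \<Longrightarrow> T s v \<in> E"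
    and commute: "s \<in> I \<Longrightarrow> t \<in> I \<Longrightarrow> v \<in> E \<Longrightarrow> T s (T t v) = T t (T s v)"
begin

lemma foldr_closed: "set xs \<subseteq> I \<Longrightarrow> v \<in> E \<Longrightarrow> foldr T xs v \<in> E"
  by (induction xs) (auto intro: closed)

lemma foldr_commute: "set xs \<subseteq> I \<Longrightarrow> s \<in> I \<Longrightarrow> v \<in> E \<Longrightarrow> foldr T xs (T s v) = T s (foldr T xs v)"
  by (induction xs) (auto simp: commute foldr_closed)

text \<open>An occurrence in ys of the first entry of xs is pulled to the front by
  \<open>foldr_commute\<close>; induction treats the remaining entries.\<close>

lemma foldr_perm:
  "mset xs = mset ys \<Longrightarrow> set xs \<subseteq> I \<Longrightarrow> v \<in> E \<Longrightarrow> foldr T xs v = foldr T ys v"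
proof (induction xs arbitrary: ys)
  case (Cons x xs)
  then have "x \<in> set ys"
    by (metis list.set_intros(1) set_mset_mset)
  then obtain ys1 ys2 where ys: "ys = ys1 @ x # ys2"
    by (meson split_list)
  have "set ys \<subseteq> I"
    using Cons.prems by (metis set_mset_mset)
  then have "foldr T ys v = T x (foldr T (ys1 @ ys2) v)"
    using Cons.prems by (simp add: ys foldr_commute foldr_closed)
  moreover have "mset xs = mset (ys1 @ ys2)"
    using Cons.prems by (simp add: ys)
  ultimately show ?case
    using Cons.IH[of "ys1 @ ys2"] Cons.prems by simp
qed simp

lemma foldr_mset_mset: "set xs \<subseteq> I \<Longrightarrow> v \<in> E \<Longrightarrow> foldr_mset T (mset xs) v = foldr T xs v"
  unfolding foldr_mset_def
  by (rule foldr_perm[symmetric]) (auto intro: someI2[of _ xs])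

lemma foldr_mset_add:
  assumes "set_mset m \<subseteq> I" "s \<in> I" "v \<in> E"
  shows "foldr_mset T (add_mset s m) v = T s (foldr_mset T m v)"
proof -
  obtain xs where m: "m = mset xs" by (metis ex_mset)
  show ?thesis
    using assms foldr_mset_mset[of "s # xs" v] foldr_mset_mset[of xs v] by (simp add: m)
qed

lemma foldr_mset_closed:
  assumes "set_mset m \<subseteq> I" "v \<in> E"
  shows "foldr_mset T m v \<in> E"
proof -
  obtain xs where m: "m = mset xs" by (metis ex_mset)
  show ?thesis
    using assms foldr_mset_mset[of xs v] foldr_closed[of xs v] by (simp add: m)
qed

end

text \<open>The weights w are arbitrary so that two evaluations share one theory: products of ring
  elements as weights give a ring homomorphism, and the coordinates of monomials applied to T_1 give
  the coordinates of f(M) T_1.\<close>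

definition monomial_sum ::
    "('a, 'm) ring_scheme \<Rightarrow> ('b, 'n) ring_scheme \<Rightarrow> ('a \<Rightarrow> 'b) \<Rightarrow> ('v multiset \<Rightarrow> 'b) \<Rightarrow> ('v multiset \<Rightarrow> 'a) \<Rightarrow> 'b"
  where "monomial_sum R S h w p = (\<Oplus>\<^bsub>S\<^esub>m \<in> {m. p m \<noteq> \<zero>\<^bsub>R\<^esub>}. h (p m) \<otimes>\<^bsub>S\<^esub> w m)"

context ring_hom_cring
begin

text \<open>Makes sums for different polynomials comparable on one finite set; the added terms
  vanish because h preserves zero.\<close>

lemma monomial_sum_superset:
  assumes "finite T" "{m. p m \<noteq> \<zero>} \<subseteq> T" "\<And>m. m \<in> T \<Longrightarrow> w m \<in> carrier S" "R.carrier_coeff p"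
  shows "monomial_sum R S h w p = (\<Oplus>\<^bsub>S\<^esub>m \<in> T. h (p m) \<otimes>\<^bsub>S\<^esub> w m)"
  unfolding monomial_sum_def
  by (rule S.add.finprod_mono_neutral_cong_left) (use assms in \<open>auto simp: R.carrier_coeff_def\<close>)

lemma monomial_sum_const:
  assumes "k \<in> carrier R" "w {#} \<in> carrier S"
  shows "monomial_sum R S h w (R.indexed_const k) = h k \<otimes>\<^bsub>S\<^esub> w {#}"
proof -
  have "monomial_sum R S h w (R.indexed_const k) = (\<Oplus>\<^bsub>S\<^esub>m \<in> {{#}}. h (R.indexed_const k m) \<otimes>\<^bsub>S\<^esub> w m)"
    by (rule monomial_sum_superset) (use assms in \<open>auto simp: R.indexed_const_def R.carrier_coeff_def\<close>)
  then show ?thesis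
    using assms by (simp add: R.indexed_const_def)
qed

context
  fixes V :: "'v set" and w :: "'v multiset \<Rightarrow> 'c"
  assumes w: "\<And>m. set_mset m \<subseteq> V \<Longrightarrow> w m \<in> carrier S"
begin

lemma monomial_sum_term_closed:
  assumes "p \<in> R.indexed_pset V (carrier R)"
  shows "(\<lambda>m. h (p m) \<otimes>\<^bsub>S\<^esub> w m) \<in> {m. p m \<noteq> \<zero>} \<rightarrow> carrier S"
  using assms w R.indexed_pset_support(2)[OF assms] R.carrier_coeff_pset[OF assms]
  by (auto simp: R.carrier_coeff_def)

lemma monomial_sum_closed:
  assumes "p \<in> R.indexed_pset V (carrier R)"
  shows "monomial_sum R S h w p \<in> carrier S"
  unfolding monomial_sum_def by (rule S.finsum_closed) (rule monomial_sum_term_closed[OF assms])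

lemma monomial_sum_padd:
  assumes "p \<in> R.indexed_pset V (carrier R)" "q \<in> R.indexed_pset V (carrier R)"
  shows "monomial_sum R S h w (R.indexed_padd p q) = monomial_sum R S h w p \<oplus>\<^bsub>S\<^esub> monomial_sum R S h w q"
proof -
  let ?T = "{m. p m \<noteq> \<zero>} \<union> {m. q m \<noteq> \<zero>}"
  have fin: "finite ?T"
    using assms R.indexed_pset_support(1) by blast
  have wT: "w m \<in> carrier S" if "m \<in> ?T" for m
    using that w assms R.indexed_pset_support(2) by blast
  note cc = assms[THEN R.carrier_coeff_pset]
  have sup: "{m. R.indexed_padd p q m \<noteq> \<zero>} \<subseteq> ?T"
    by (auto simp: R.indexed_padd_def)
  have "monomial_sum R S h w (R.indexed_padd p q) = (\<Oplus>\<^bsub>S\<^esub>m \<in> ?T. h (R.indexed_padd p q m) \<otimes>\<^bsub>S\<^esub> w m)"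
    by (rule monomial_sum_superset[OF fin sup wT R.indexed_padd_in_carrier[OF cc]])
  also have "\<dots> = (\<Oplus>\<^bsub>S\<^esub>m \<in> ?T. h (p m) \<otimes>\<^bsub>S\<^esub> w m \<oplus>\<^bsub>S\<^esub> h (q m) \<otimes>\<^bsub>S\<^esub> w m)"
    using cc wT by (intro S.finsum_cong') (auto simp: R.indexed_padd_def R.carrier_coeff_def S.l_distr)
  also have "\<dots> = (\<Oplus>\<^bsub>S\<^esub>m \<in> ?T. h (p m) \<otimes>\<^bsub>S\<^esub> w m) \<oplus>\<^bsub>S\<^esub> (\<Oplus>\<^bsub>S\<^esub>m \<in> ?T. h (q m) \<otimes>\<^bsub>S\<^esub> w m)"
    using cc wT by (intro S.finsum_addf) (auto simp: R.carrier_coeff_def)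
  also have "\<dots> = monomial_sum R S h w p \<oplus>\<^bsub>S\<^esub> monomial_sum R S h w q"
    using monomial_sum_superset[OF fin _ wT cc(1)] monomial_sum_superset[OF fin _ wT cc(2)] by simp
  finally show ?thesis .
qed

lemma monomial_sum_scale:
  assumes "p \<in> R.indexed_pset V (carrier R)" "k \<in> carrier R"
  shows "monomial_sum R S h w (\<lambda>m. k \<otimes> p m) = h k \<otimes>\<^bsub>S\<^esub> monomial_sum R S h w p"
proof -
  note cc = R.carrier_coeff_pset[OF assms(1)]
  have "monomial_sum R S h w (\<lambda>m. k \<otimes> p m) = (\<Oplus>\<^bsub>S\<^esub>m \<in> {m. p m \<noteq> \<zero>}. h (k \<otimes> p m) \<otimes>\<^bsub>S\<^esub> w m)"
    using R.indexed_pset_support[OF assms(1)] w assms cc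
    by (intro monomial_sum_superset) (auto simp: R.carrier_coeff_def)
  also have "\<dots> = (\<Oplus>\<^bsub>S\<^esub>m \<in> {m. p m \<noteq> \<zero>}. h k \<otimes>\<^bsub>S\<^esub> (h (p m) \<otimes>\<^bsub>S\<^esub> w m))"
    using R.indexed_pset_support[OF assms(1)] w assms cc
    by (intro S.finsum_cong') (auto simp: R.carrier_coeff_def S.m_assoc)
  also have "\<dots> = h k \<otimes>\<^bsub>S\<^esub> monomial_sum R S h w p"
    unfolding monomial_sum_def
    using R.indexed_pset_support[OF assms(1)] assms monomial_sum_term_closed[OF assms(1)]
    by (intro S.finsum_rdistr[symmetric]) auto
  finally show ?thesis .
qed

text \<open>The support of the product is the support of p shifted by i, so the variable can be
  absorbed into the weight.\<close>

lemma monomial_sum_pmult: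
  assumes "p \<in> R.indexed_pset V (carrier R)" "i \<in> V"
  shows "monomial_sum R S h w (R.indexed_pmult p i) = monomial_sum R S h (\<lambda>m. w (add_mset i m)) p"
proof -
  have supp: "{m. R.indexed_pmult p i m \<noteq> \<zero>} = add_mset i ` {m. p m \<noteq> \<zero>}"
    by (force simp: R.indexed_pmult_def image_iff split: if_splits)
  have "monomial_sum R S h w (R.indexed_pmult p i)
      = (\<Oplus>\<^bsub>S\<^esub>m \<in> {m. p m \<noteq> \<zero>}. h (R.indexed_pmult p i (add_mset i m)) \<otimes>\<^bsub>S\<^esub> w (add_mset i m))"
    unfolding monomial_sum_def supp
    using R.indexed_pset_support(2)[OF assms(1)] w assms R.carrier_coeff_pset[OF assms(1)]
    by (intro S.finsum_reindex) (auto simp: R.indexed_pmult_def R.carrier_coeff_def inj_on_def)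
  then show ?thesis
    by (simp add: monomial_sum_def R.indexed_pmult_def)
qed

end

lemma monomial_sum_cong:
  assumes "p \<in> R.indexed_pset V (carrier R)"
    and "\<And>m. set_mset m \<subseteq> V \<Longrightarrow> w m = w' m" "\<And>m. set_mset m \<subseteq> V \<Longrightarrow> w' m \<in> carrier S"
  shows "monomial_sum R S h w p = monomial_sum R S h w' p"
  unfolding monomial_sum_def
  by (rule S.finsum_cong')
     (use assms R.indexed_pset_support(2)[OF assms(1)] R.carrier_coeff_pset[OF assms(1)]
      in \<open>auto simp: R.carrier_coeff_def\<close>)

text \<open>An exchange of two sums. The weights are generalised in the induction because a variable
  replaces each \<open>w j\<close> by its shift. With a singleton J it extracts a scalar, with J =
  {1..n} a row of a matrix.\<close>

lemma monomial_sum_linear: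
  fixes V :: "'v set"
  assumes "p \<in> R.indexed_pset V (carrier R)" "finite J"
    and "c \<in> J \<rightarrow> carrier S" "\<And>j m. j \<in> J \<Longrightarrow> set_mset m \<subseteq> V \<Longrightarrow> w j m \<in> carrier S"
  shows "monomial_sum R S h (\<lambda>m. \<Oplus>\<^bsub>S\<^esub>j\<in>J. c j \<otimes>\<^bsub>S\<^esub> w j m) p
    = (\<Oplus>\<^bsub>S\<^esub>j\<in>J. c j \<otimes>\<^bsub>S\<^esub> monomial_sum R S h (w j) p)"
  using assms(1,4)
proof (induction p arbitrary: w)
  case (indexed_const k)
  have "monomial_sum R S h (\<lambda>m. \<Oplus>\<^bsub>S\<^esub>j\<in>J. c j \<otimes>\<^bsub>S\<^esub> w j m) (R.indexed_const k)
      = h k \<otimes>\<^bsub>S\<^esub> (\<Oplus>\<^bsub>S\<^esub>j\<in>J. c j \<otimes>\<^bsub>S\<^esub> w j {#})"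
    using indexed_const assms(3) by (intro monomial_sum_const S.finsum_closed) auto
  also have "\<dots> = (\<Oplus>\<^bsub>S\<^esub>j\<in>J. h k \<otimes>\<^bsub>S\<^esub> (c j \<otimes>\<^bsub>S\<^esub> w j {#}))"
    using indexed_const assms(2,3) by (intro S.finsum_rdistr) auto
  also have "\<dots> = (\<Oplus>\<^bsub>S\<^esub>j\<in>J. c j \<otimes>\<^bsub>S\<^esub> monomial_sum R S h (w j) (R.indexed_const k))"
    using indexed_const assms(3)
    by (intro S.finsum_cong') (auto simp: monomial_sum_const Pi_iff intro!: S.m_lcomm)
  finally show ?case .
next
  case (indexed_padd p q)
  have wc: "\<And>m. set_mset m \<subseteq> V \<Longrightarrow> (\<Oplus>\<^bsub>S\<^esub>j\<in>J. c j \<otimes>\<^bsub>S\<^esub> w j m) \<in> carrier S"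
    using indexed_padd assms(3) by (intro S.finsum_closed) auto
  have cl: "monomial_sum R S h (w j) p \<in> carrier S" "monomial_sum R S h (w j) q \<in> carrier S" if "j \<in> J" for j
    using that indexed_padd by (auto intro!: monomial_sum_closed)
  have "monomial_sum R S h (\<lambda>m. \<Oplus>\<^bsub>S\<^esub>j\<in>J. c j \<otimes>\<^bsub>S\<^esub> w j m) (R.indexed_padd p q)
      = (\<Oplus>\<^bsub>S\<^esub>j\<in>J. c j \<otimes>\<^bsub>S\<^esub> monomial_sum R S h (w j) p) \<oplus>\<^bsub>S\<^esub> (\<Oplus>\<^bsub>S\<^esub>j\<in>J. c j \<otimes>\<^bsub>S\<^esub> monomial_sum R S h (w j) q)"
    using indexed_padd wc by (subst monomial_sum_padd[of V]) auto
  also have "\<dots> = (\<Oplus>\<^bsub>S\<^esub>j\<in>J. c j \<otimes>\<^bsub>S\<^esub> monomial_sum R S h (w j) p \<oplus>\<^bsub>S\<^esub> c j \<otimes>\<^bsub>S\<^esub> monomial_sum R S h (w j) q)"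
    using cl assms(3) by (intro S.finsum_addf[symmetric]) auto
  also have "\<dots> = (\<Oplus>\<^bsub>S\<^esub>j\<in>J. c j \<otimes>\<^bsub>S\<^esub> monomial_sum R S h (w j) (R.indexed_padd p q))"
  proof (intro S.finsum_cong' refl)
    fix j assume j: "j \<in> J"
    have "monomial_sum R S h (w j) (R.indexed_padd p q) = monomial_sum R S h (w j) p \<oplus>\<^bsub>S\<^esub> monomial_sum R S h (w j) q"
      using indexed_padd j by (intro monomial_sum_padd) auto
    then show "c j \<otimes>\<^bsub>S\<^esub> monomial_sum R S h (w j) p \<oplus>\<^bsub>S\<^esub> c j \<otimes>\<^bsub>S\<^esub> monomial_sum R S h (w j) q
      = c j \<otimes>\<^bsub>S\<^esub> monomial_sum R S h (w j) (R.indexed_padd p q)"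
      using cl j assms(3) by (auto simp: Pi_iff S.r_distr)
  qed (use assms(3) indexed_padd in \<open>auto intro!: S.m_closed monomial_sum_closed R.indexed_pset.indexed_padd\<close>)
  finally show ?case .
next
  case (indexed_pmult p i)
  have wc: "\<And>m. set_mset m \<subseteq> V \<Longrightarrow> (\<Oplus>\<^bsub>S\<^esub>j\<in>J. c j \<otimes>\<^bsub>S\<^esub> w j m) \<in> carrier S"
    using indexed_pmult assms(3) by (intro S.finsum_closed) auto
  have "monomial_sum R S h (\<lambda>m. \<Oplus>\<^bsub>S\<^esub>j\<in>J. c j \<otimes>\<^bsub>S\<^esub> w j m) (R.indexed_pmult p i)
      = (\<Oplus>\<^bsub>S\<^esub>j\<in>J. c j \<otimes>\<^bsub>S\<^esub> monomial_sum R S h (\<lambda>m. w j (add_mset i m)) p)"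
    using indexed_pmult wc by (subst monomial_sum_pmult[of V]) auto
  also have "\<dots> = (\<Oplus>\<^bsub>S\<^esub>j\<in>J. c j \<otimes>\<^bsub>S\<^esub> monomial_sum R S h (w j) (R.indexed_pmult p i))"
  proof (intro S.finsum_cong' refl)
    fix j assume j: "j \<in> J"
    have "monomial_sum R S h (w j) (R.indexed_pmult p i) = monomial_sum R S h (\<lambda>m. w j (add_mset i m)) p"
      using indexed_pmult j by (intro monomial_sum_pmult) auto
    then show "c j \<otimes>\<^bsub>S\<^esub> monomial_sum R S h (\<lambda>m. w j (add_mset i m)) p
      = c j \<otimes>\<^bsub>S\<^esub> monomial_sum R S h (w j) (R.indexed_pmult p i)"
      by simp
  qed (use assms(3) indexed_pmult in \<open>auto intro!: S.m_closed monomial_sum_closed R.indexed_pset.indexed_pmult\<close>)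
  finally show ?case .
qed

text \<open>The existence half of the universal property of the polynomial ring. The weight of a
  monomial is the product of the corresponding \<open>x i\<close>; multiplicativity follows by
  induction on the left factor once multiplication by one variable is understood.\<close>

theorem indexed_poly_eval_exists:
  fixes V :: "'v set"
  assumes x: "x \<in> V \<rightarrow> carrier S"
  obtains \<phi> where "ring_hom_cring (indexed_poly_ring R V) S \<phi>"
    and "\<And>k. k \<in> carrier R \<Longrightarrow> \<phi> (R.indexed_const k) = h k"
    and "\<And>i. i \<in> V \<Longrightarrow> \<phi> (R.indexed_var i) = x i"
proof -
  interpret T: commuting_operators V "carrier S" "\<lambda>i. (\<otimes>\<^bsub>S\<^esub>) (x i)"
    using x by unfold_locales (auto simp: Pi_iff intro!: S.m_lcomm)
  define w where "w m = foldr_mset (\<lambda>i. (\<otimes>\<^bsub>S\<^esub>) (x i)) m \<one>\<^bsub>S\<^esub>" for m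
  have w_closed: "w m \<in> carrier S" if "set_mset m \<subseteq> V" for m
    using that by (auto simp: w_def intro: T.foldr_mset_closed)
  have w_empty: "w {#} = \<one>\<^bsub>S\<^esub>"
    by (simp add: w_def)
  have w_add: "w (add_mset i m) = x i \<otimes>\<^bsub>S\<^esub> w m" if "set_mset m \<subseteq> V" "i \<in> V" for i m
    using that by (simp add: w_def T.foldr_mset_add)
  define \<phi> where "\<phi> = monomial_sum R S h w"
  have const: "\<phi> (R.indexed_const k) = h k" if "k \<in> carrier R" for k
    using that by (simp add: \<phi>_def monomial_sum_const w_empty)
  have closed: "\<phi> p \<in> carrier S" if "p \<in> R.indexed_pset V (carrier R)" for p
    unfolding \<phi>_def using w_closed that by (rule monomial_sum_closed)
  have padd: "\<phi> (R.indexed_padd p q) = \<phi> p \<oplus>\<^bsub>S\<^esub> \<phi> q"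
    if "p \<in> R.indexed_pset V (carrier R)" "q \<in> R.indexed_pset V (carrier R)" for p q
    unfolding \<phi>_def using w_closed that by (rule monomial_sum_padd)
  have pmult: "\<phi> (R.indexed_pmult p i) = x i \<otimes>\<^bsub>S\<^esub> \<phi> p"
    if p: "p \<in> R.indexed_pset V (carrier R)" and i: "i \<in> V" for p i
  proof -
    \<comment> \<open>The singleton sum brings the factor \<open>x i\<close> into the shape from
      which \<open>monomial_sum_linear\<close> extracts it.\<close>
    have "\<phi> (R.indexed_pmult p i) = monomial_sum R S h (\<lambda>m. \<Oplus>\<^bsub>S\<^esub>j\<in>{i}. x i \<otimes>\<^bsub>S\<^esub> w m) p"
      unfolding \<phi>_def using w_closed p i x
      by (subst monomial_sum_pmult[of V]) (auto intro!: monomial_sum_cong[OF p] simp: w_add Pi_iff)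
    also have "\<dots> = (\<Oplus>\<^bsub>S\<^esub>j\<in>{i}. x i \<otimes>\<^bsub>S\<^esub> \<phi> p)"
      unfolding \<phi>_def using i x w_closed by (intro monomial_sum_linear[OF p]) auto
    also have "\<dots> = x i \<otimes>\<^bsub>S\<^esub> \<phi> p"
      using i x closed[OF p] by (simp add: Pi_iff)
    finally show ?thesis .
  qed
  have times: "\<phi> (R.indexed_times p q) = \<phi> p \<otimes>\<^bsub>S\<^esub> \<phi> q"
    if p: "p \<in> R.indexed_pset V (carrier R)" and q: "q \<in> R.indexed_pset V (carrier R)" for p q
    using p
  proof induction
    case (indexed_const k)
    then show ?case
      using q const w_closed
      by (simp add: R.indexed_times_const_left R.carrier_coeff_pset \<phi>_def monomial_sum_scale[of V])
  next
    case (indexed_padd p p')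
    then show ?case
      using q closed
      by (simp add: R.indexed_times_padd_left R.carrier_coeff_pset padd R.indexed_times_closed S.l_distr)
  next
    case (indexed_pmult p i)
    then show ?case
      using q closed x
      by (auto simp: R.indexed_times_pmult_left R.carrier_coeff_pset pmult R.indexed_times_closed S.m_assoc Pi_iff)
  qed
  have hom: "ring_hom_cring (indexed_poly_ring R V) S \<phi>"
  proof (intro ring_hom_cring.intro ring_hom_cring_axioms.intro ring_hom_memI)
    show "cring (indexed_poly_ring R V)" "cring S"
      by (rule R.cring_indexed_poly_ring) (rule S.cring_axioms)
  qed (use const closed padd times in \<open>auto simp: R.indexed_poly_ring_simps\<close>)
  have "\<phi> (R.indexed_var i) = x i" if "i \<in> V" for i
    using that x const[of \<one>]
    by (auto simp: R.indexed_var_def pmult[OF R.indexed_pset.indexed_const] Pi_iff)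
  with hom const show thesis
    by (rule that)
qed

end

section \<open>Matrices as operators on vectors\<close>

lemma (in abelian_monoid) finsum_swap:
  assumes "finite I" "finite J" "\<And>i j. i \<in> I \<Longrightarrow> j \<in> J \<Longrightarrow> f i j \<in> carrier G"
  shows "(\<Oplus>i\<in>I. \<Oplus>j\<in>J. f i j) = (\<Oplus>j\<in>J. \<Oplus>i\<in>I. f i j)"
  using assms(1,3)
proof (induction I)
  case (insert i I)
  have "(\<Oplus>j\<in>J. \<Oplus>i\<in>insert i I. f i j) = (\<Oplus>j\<in>J. f i j \<oplus> (\<Oplus>i\<in>I. f i j))"
    using insert by (intro finsum_cong') (auto simp: Pi_iff)
  also have "\<dots> = (\<Oplus>j\<in>J. f i j) \<oplus> (\<Oplus>j\<in>J. \<Oplus>i\<in>I. f i j)"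
    using insert by (intro finsum_addf) (auto simp: Pi_iff)
  also have "\<dots> = (\<Oplus>i\<in>insert i I. \<Oplus>j\<in>J. f i j)"
    using insert by (subst finsum_insert) (auto simp: Pi_iff)
  finally show ?case ..
qed simp

text \<open>Extensional functions, so that vectors with equal coordinates are equal and iterates of
  \<open>mat_op\<close> can be compared as functions. Matrices are not made extensional:
  \<open>mats\<close> constrains only the entries that carry meaning.\<close>

definition vecs :: "('a, 'm) ring_scheme \<Rightarrow> nat \<Rightarrow> (nat \<Rightarrow> 'a) set"
  where "vecs R n = {1..n} \<rightarrow>\<^sub>E carrier R"

definition mats :: "('a, 'm) ring_scheme \<Rightarrow> nat \<Rightarrow> (nat \<Rightarrow> nat \<Rightarrow> 'a) set"
  where "mats R n = {M. \<forall>i\<in>{1..n}. \<forall>j\<in>{1..n}. M i j \<in> carrier R}"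

definition mat_op :: "('a, 'm) ring_scheme \<Rightarrow> nat \<Rightarrow> (nat \<Rightarrow> nat \<Rightarrow> 'a) \<Rightarrow> (nat \<Rightarrow> 'a) \<Rightarrow> nat \<Rightarrow> 'a"
  where "mat_op R n M v = restrict (mat_act R n M v) {1..n}"

definition unit_vec :: "('a, 'm) ring_scheme \<Rightarrow> nat \<Rightarrow> nat \<Rightarrow> nat \<Rightarrow> 'a"
  where "unit_vec R n k = restrict (basis_vec R k) {1..n}"

lemma mat_op_apply:
  "i \<in> {1..n} \<Longrightarrow> mat_op R n M v i = (\<Oplus>\<^bsub>R\<^esub>j\<in>{1..n}. M i j \<otimes>\<^bsub>R\<^esub> v j)"
  by (simp add: mat_op_def mat_act_def)

lemma vecsD: "v \<in> vecs R n \<Longrightarrow> i \<in> {1..n} \<Longrightarrow> v i \<in> carrier R"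
  by (auto simp: vecs_def PiE_def)

lemma restrict_in_vecs: "(\<And>i. i \<in> {1..n} \<Longrightarrow> f i \<in> carrier R) \<Longrightarrow> restrict f {1..n} \<in> vecs R n"
  by (simp add: vecs_def)

lemma vecs_eqI:
  assumes "v \<in> vecs R n" "w \<in> vecs R n" "\<And>i. i \<in> {1..n} \<Longrightarrow> v i = w i"
  shows "v = w"
  using assms unfolding vecs_def by (rule PiE_ext)

lemma matsD: "M \<in> mats R n \<Longrightarrow> i \<in> {1..n} \<Longrightarrow> j \<in> {1..n} \<Longrightarrow> M i j \<in> carrier R"
  by (simp add: mats_def)

context cring
begin

lemma unit_vec_closed: "unit_vec R n k \<in> vecs R n"
  unfolding unit_vec_def by (rule restrict_in_vecs) (simp add: basis_vec_def)

lemma mat_op_closed: "M \<in> mats R n \<Longrightarrow> v \<in> vecs R n \<Longrightarrow> mat_op R n M v \<in> vecs R n"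
  unfolding mat_op_def mat_act_def
  by (intro restrict_in_vecs finsum_closed) (auto simp: mats_def dest: vecsD)

lemma mat_op_pow_closed: "M \<in> mats R n \<Longrightarrow> v \<in> vecs R n \<Longrightarrow> (mat_op R n M ^^ k) v \<in> vecs R n"
  by (induction k) (auto intro: mat_op_closed)

lemma mat_op_cong:
  assumes "M' \<in> mats R n" "v' \<in> vecs R n"
    and "\<And>i j. i \<in> {1..n} \<Longrightarrow> j \<in> {1..n} \<Longrightarrow> M i j = M' i j" "\<And>j. j \<in> {1..n} \<Longrightarrow> v j = v' j"
  shows "mat_op R n M v = mat_op R n M' v'"
  unfolding mat_op_def mat_act_def
  by (intro restrict_ext finsum_cong') (use assms in \<open>auto simp: mats_def dest: vecsD\<close>)

lemma mat_mult_closed: "M \<in> mats R n \<Longrightarrow> N \<in> mats R n \<Longrightarrow> mat_mult R n M N \<in> mats R n"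
  by (auto simp: mats_def mat_mult_def intro!: finsum_closed)

lemma mat_one_closed: "mat_one R \<in> mats R n"
  by (simp add: mats_def mat_one_def)

lemma mat_pow_closed: "M \<in> mats R n \<Longrightarrow> mat_pow R n M k \<in> mats R n"
  unfolding mat_pow_def by (induction k) (auto intro: mat_mult_closed mat_one_closed)

text \<open>Turns matrix products into composition of operators, so that identities between matrices
  can be checked on vectors.\<close>

lemma mat_op_mult:
  assumes "M \<in> mats R n" "N \<in> mats R n" "v \<in> vecs R n"
  shows "mat_op R n (mat_mult R n M N) v = mat_op R n M (mat_op R n N v)"
proof (rule vecs_eqI)
  fix i assume i: "i \<in> {1..n}"
  note cl = matsD[OF assms(1)] matsD[OF assms(2)] vecsD[OF assms(3)]
  have "mat_op R n (mat_mult R n M N) v i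
      = (\<Oplus>j\<in>{1..n}. \<Oplus>k\<in>{1..n}. M i k \<otimes> (N k j \<otimes> v j))"
    unfolding mat_op_apply[OF i] mat_mult_def
  proof (intro finsum_cong' refl)
    fix j assume j: "j \<in> {1..n}"
    have "(\<Oplus>k\<in>{1..n}. M i k \<otimes> N k j) \<otimes> v j = (\<Oplus>k\<in>{1..n}. M i k \<otimes> N k j \<otimes> v j)"
      using i j cl by (intro finsum_ldistr) auto
    also have "\<dots> = (\<Oplus>k\<in>{1..n}. M i k \<otimes> (N k j \<otimes> v j))"
      using i j cl by (intro finsum_cong') (auto simp: m_assoc)
    finally show "(\<Oplus>k\<in>{1..n}. M i k \<otimes> N k j) \<otimes> v j = (\<Oplus>k\<in>{1..n}. M i k \<otimes> (N k j \<otimes> v j))" .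
  qed (use i cl in \<open>auto intro!: finsum_closed\<close>)
  also have "\<dots> = (\<Oplus>k\<in>{1..n}. \<Oplus>j\<in>{1..n}. M i k \<otimes> (N k j \<otimes> v j))"
    using i cl by (intro finsum_swap) auto
  also have "\<dots> = (\<Oplus>k\<in>{1..n}. M i k \<otimes> mat_op R n N v k)"
    using i cl mat_op_closed[OF assms(2,3), THEN vecsD]
    by (intro finsum_cong' refl) (auto simp: mat_op_apply intro!: finsum_rdistr[symmetric])
  also have "\<dots> = mat_op R n M (mat_op R n N v) i"
    by (simp only: mat_op_apply[OF i])
  finally show "mat_op R n (mat_mult R n M N) v i = mat_op R n M (mat_op R n N v) i" .
qed (use assms in \<open>auto intro!: mat_op_closed mat_mult_closed\<close>)

lemma mat_op_one:
  assumes "v \<in> vecs R n"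
  shows "mat_op R n (mat_one R) v = v"
proof (rule vecs_eqI)
  fix i assume i: "i \<in> {1..n}"
  have "mat_op R n (mat_one R) v i = (\<Oplus>j\<in>{1..n}. if i = j then v j else \<zero>)"
    unfolding mat_op_apply[OF i] mat_one_def
    using vecsD[OF assms] by (intro finsum_cong') auto
  also have "\<dots> = v i"
    using i vecsD[OF assms] by (intro finsum_singleton) auto
  finally show "mat_op R n (mat_one R) v i = v i" .
qed (use assms in \<open>auto intro!: mat_op_closed mat_one_closed\<close>)

lemma mat_op_pow:
  assumes "M \<in> mats R n" "v \<in> vecs R n"
  shows "mat_op R n (mat_pow R n M k) v = (mat_op R n M ^^ k) v"
proof (induction k)
  case 0
  then show ?case using assms by (simp add: mat_pow_def mat_op_one)
next
  case (Suc k)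
  have "mat_op R n (mat_pow R n M (Suc k)) v = mat_op R n (mat_mult R n M (mat_pow R n M k)) v"
    by (simp add: mat_pow_def)
  with Suc show ?case
    using assms by (simp add: mat_op_mult mat_pow_closed)
qed

lemma mat_act_basis_vec:
  assumes "M \<in> mats R n" "i \<in> {1..n}" "k \<in> {1..n}"
  shows "mat_act R n M (basis_vec R k) i = M i k"
proof -
  have "mat_act R n M (basis_vec R k) i = (\<Oplus>j\<in>{1..n}. if j = k then M i j else \<zero>)"
    unfolding mat_act_def basis_vec_def
    using assms by (intro finsum_cong') (auto simp: mats_def)
  also have "\<dots> = M i k"
    using assms by (intro add.finprod_singleton_swap) (auto simp: mats_def)
  finally show ?thesis .
qed

lemma mat_op_unit_vec:
  assumes "M \<in> mats R n" "k \<in> {1..n}" "i \<in> {1..n}"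
  shows "mat_op R n M (unit_vec R n k) i = M i k"
proof -
  have "mat_op R n M (unit_vec R n k) i = mat_act R n M (basis_vec R k) i"
    unfolding mat_op_apply[OF assms(3)] mat_act_def unit_vec_def
    using assms by (intro finsum_cong') (auto simp: mats_def basis_vec_def)
  then show ?thesis
    using assms by (simp add: mat_act_basis_vec)
qed

lemma mat_mult_eq_mat_op:
  assumes "M \<in> mats R n" "N \<in> mats R n" "i \<in> {1..n}" "j \<in> {1..n}"
  shows "mat_mult R n M N i j = mat_op R n M (mat_op R n N (unit_vec R n j)) i"
  using assms by (simp add: mat_op_mult[symmetric] unit_vec_closed mat_op_unit_vec mat_mult_closed)

lemma mat_op_commute:
  assumes "M \<in> mats R n" "N \<in> mats R n" "v \<in> vecs R n"
    and "\<And>i j. i \<in> {1..n} \<Longrightarrow> j \<in> {1..n} \<Longrightarrow> mat_mult R n M N i j = mat_mult R n N M i j"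
  shows "mat_op R n M (mat_op R n N v) = mat_op R n N (mat_op R n M v)"
  using assms mat_op_cong[of "mat_mult R n N M" n v "mat_mult R n M N" v]
  by (simp add: mat_op_mult[symmetric] mat_mult_closed)

lemma unit_vec_expansion:
  assumes "i \<in> {1..n}" "c \<in> {1..n} \<rightarrow> carrier R"
  shows "(\<Oplus>k\<in>{1..n}. c k \<otimes> unit_vec R n k i) = c i"
proof -
  have "(\<Oplus>k\<in>{1..n}. c k \<otimes> unit_vec R n k i) = (\<Oplus>k\<in>{1..n}. if i = k then c k else \<zero>)"
    using assms by (intro finsum_cong') (auto simp: unit_vec_def basis_vec_def Pi_iff)
  also have "\<dots> = c i"
    using assms by (intro finsum_singleton) auto
  finally show ?thesis .
qed

lemma mat_op_linear:
  assumes "M \<in> mats R n" "finite K" "c \<in> K \<rightarrow> carrier R" "v \<in> K \<rightarrow> vecs R n"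
  shows "mat_op R n M (\<lambda>i\<in>{1..n}. \<Oplus>k\<in>K. c k \<otimes> v k i)
    = (\<lambda>i\<in>{1..n}. \<Oplus>k\<in>K. c k \<otimes> mat_op R n M (v k) i)"
proof (rule vecs_eqI)
  have v: "k \<in> K \<Longrightarrow> i \<in> {1..n} \<Longrightarrow> v k i \<in> carrier R" for i k
    using assms(4) vecsD by blast
  have c: "k \<in> K \<Longrightarrow> c k \<in> carrier R" for k
    using assms(3) by blast
  note M = matsD[OF assms(1)]
  have Mv: "k \<in> K \<Longrightarrow> i \<in> {1..n} \<Longrightarrow> mat_op R n M (v k) i \<in> carrier R" for i k
    using assms mat_op_closed vecsD by blast
  show "mat_op R n M (\<lambda>i\<in>{1..n}. \<Oplus>k\<in>K. c k \<otimes> v k i) \<in> vecs R n"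
    using c v by (intro mat_op_closed assms(1) restrict_in_vecs finsum_closed) auto
  show "(\<lambda>i\<in>{1..n}. \<Oplus>k\<in>K. c k \<otimes> mat_op R n M (v k) i) \<in> vecs R n"
    using c Mv by (intro restrict_in_vecs finsum_closed) auto
  fix i assume i: "i \<in> {1..n}"
  have "mat_op R n M (\<lambda>i\<in>{1..n}. \<Oplus>k\<in>K. c k \<otimes> v k i) i
      = (\<Oplus>j\<in>{1..n}. \<Oplus>k\<in>K. c k \<otimes> (M i j \<otimes> v k j))"
    unfolding mat_op_apply[OF i]
  proof (intro finsum_cong' refl)
    fix j assume j: "j \<in> {1..n}"
    have "M i j \<otimes> (\<Oplus>k\<in>K. c k \<otimes> v k j) = (\<Oplus>k\<in>K. M i j \<otimes> (c k \<otimes> v k j))"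
      using i j c v M assms(2) by (intro finsum_rdistr) auto
    also have "\<dots> = (\<Oplus>k\<in>K. c k \<otimes> (M i j \<otimes> v k j))"
      using i j c v M by (intro finsum_cong') (auto intro!: m_lcomm)
    finally show "M i j \<otimes> (\<lambda>i\<in>{1..n}. \<Oplus>k\<in>K. c k \<otimes> v k i) j = (\<Oplus>k\<in>K. c k \<otimes> (M i j \<otimes> v k j))"
      using j by simp
  qed (use i c v M in \<open>auto intro!: finsum_closed\<close>)
  also have "\<dots> = (\<Oplus>k\<in>K. \<Oplus>j\<in>{1..n}. c k \<otimes> (M i j \<otimes> v k j))"
    using i c v M assms(2) by (intro finsum_swap) auto
  also have "\<dots> = (\<Oplus>k\<in>K. c k \<otimes> mat_op R n M (v k) i)"
    using i c v M Mv
    by (intro finsum_cong' refl) (auto simp: mat_op_apply intro!: finsum_rdistr[symmetric])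
  finally show "mat_op R n M (\<lambda>i\<in>{1..n}. \<Oplus>k\<in>K. c k \<otimes> v k i) i
      = (\<lambda>i\<in>{1..n}. \<Oplus>k\<in>K. c k \<otimes> mat_op R n M (v k) i) i"
    using i by simp
qed

lemma mat_monomial_closed:
  assumes "\<And>s. s \<in> I \<Longrightarrow> M s \<in> mats R n" "set_mset m \<subseteq> I"
  shows "mat_monomial R n M m \<in> mats R n"
proof -
  have "set xs \<subseteq> I \<Longrightarrow> foldr (\<lambda>s. mat_mult R n (M s)) xs (mat_one R) \<in> mats R n" for xs
    by (induction xs) (auto intro!: mat_mult_closed mat_one_closed assms)
  moreover have "mset (SOME xs. mset xs = m) = m"
    by (rule someI_ex) (rule ex_mset)
  ultimately show ?thesis
    unfolding mat_monomial_def using assms(2) by (metis set_mset_mset)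
qed

text \<open>Both sides unfold the same chosen list, so an induction on lists suffices. Membership in
  \<open>mats\<close> is carried along because \<open>mat_op_mult\<close> asks for it.\<close>

lemma mat_op_monomial:
  assumes "\<And>s. s \<in> I \<Longrightarrow> M s \<in> mats R n" "set_mset m \<subseteq> I" "v \<in> vecs R n"
  shows "mat_op R n (mat_monomial R n M m) v = foldr_mset (\<lambda>s. mat_op R n (M s)) m v"
proof -
  have "foldr (\<lambda>s. mat_mult R n (M s)) xs (mat_one R) \<in> mats R n
    \<and> mat_op R n (foldr (\<lambda>s. mat_mult R n (M s)) xs (mat_one R)) v = foldr (\<lambda>s. mat_op R n (M s)) xs v"
    if "set xs \<subseteq> I" for xs
    using that assms by (induction xs) (auto simp: mat_op_one mat_op_mult mat_mult_closed mat_one_closed)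
  moreover have "mset (SOME xs. mset xs = m) = m"
    by (rule someI_ex) (rule ex_mset)
  ultimately show ?thesis
    unfolding mat_monomial_def foldr_mset_def using assms(2) by (metis set_mset_mset)
qed

end

section \<open>Matrices under a ring homomorphism\<close>

context ring_hom_cring
begin

lemma mats_hom: "M \<in> mats R n \<Longrightarrow> (\<lambda>i j. h (M i j)) \<in> mats S n"
  by (simp add: mats_def)

lemma unit_vec_hom: "(\<lambda>i\<in>{1..n}. h (unit_vec R n k i)) = unit_vec S n k"
  by (auto simp: unit_vec_def basis_vec_def)

lemma mat_op_hom:
  assumes "M \<in> mats R n" "v \<in> vecs R n"
  shows "(\<lambda>i\<in>{1..n}. h (mat_op R n M v i)) = mat_op S n (\<lambda>i j. h (M i j)) (\<lambda>i\<in>{1..n}. h (v i))"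
  unfolding mat_op_def mat_act_def
proof (rule restrict_ext)
  fix i assume i: "i \<in> {1..n}"
  note cl = matsD[OF assms(1)] vecsD[OF assms(2)]
  have "h (\<Oplus>j\<in>{1..n}. M i j \<otimes> v j) = (\<Oplus>\<^bsub>S\<^esub>j\<in>{1..n}. h (M i j \<otimes> v j))"
    using i cl by (subst hom_finsum) (auto simp: o_def)
  also have "\<dots> = (\<Oplus>\<^bsub>S\<^esub>j\<in>{1..n}. h (M i j) \<otimes>\<^bsub>S\<^esub> (\<lambda>i\<in>{1..n}. h (v i)) j)"
    using i cl by (intro S.finsum_cong') auto
  finally show "h ((\<lambda>i\<in>{1..n}. \<Oplus>j\<in>{1..n}. M i j \<otimes> v j) i)
    = (\<Oplus>\<^bsub>S\<^esub>j\<in>{1..n}. h (M i j) \<otimes>\<^bsub>S\<^esub> (\<lambda>i\<in>{1..n}. h (v i)) j)"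
    using i by simp
qed

lemma mat_op_pow_hom:
  assumes "M \<in> mats R n" "v \<in> vecs R n"
  shows "(\<lambda>i\<in>{1..n}. h ((mat_op R n M ^^ k) v i))
    = (mat_op S n (\<lambda>i j. h (M i j)) ^^ k) (\<lambda>i\<in>{1..n}. h (v i))"
proof (induction k)
  case (Suc k)
  have "(\<lambda>i\<in>{1..n}. h ((mat_op R n M ^^ Suc k) v i))
      = mat_op S n (\<lambda>i j. h (M i j)) (\<lambda>i\<in>{1..n}. h ((mat_op R n M ^^ k) v i))"
    unfolding funpow.simps o_apply using assms by (intro mat_op_hom R.mat_op_pow_closed)
  then show ?case
    by (simp only: Suc funpow.simps o_apply)
qed simp

lemma mat_mult_hom:
  assumes "M \<in> mats R n" "N \<in> mats R n" "i \<in> {1..n}" "j \<in> {1..n}"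
  shows "h (mat_mult R n M N i j) = mat_mult S n (\<lambda>i j. h (M i j)) (\<lambda>i j. h (N i j)) i j"
  unfolding mat_mult_def
  using assms by (subst hom_finsum) (auto simp: mats_def o_def intro!: S.finsum_cong')

end

section \<open>Polynomials in commuting matrices with a cyclic vector\<close>

declare One_nat_def [simp del]

context cring
begin

lemma const_ring_hom: "ring_hom_cring R (indexed_poly_ring R V) indexed_const"
proof (intro ring_hom_cring.intro ring_hom_cring_axioms.intro cring_indexed_poly_ring cring_axioms ring_hom_memI)
  fix a b assume "a \<in> carrier R" "b \<in> carrier R"
  then show "indexed_const (a \<otimes> b) = indexed_const a \<otimes>\<^bsub>indexed_poly_ring R V\<^esub> indexed_const b"
    by (auto simp: indexed_poly_ring_simps indexed_times_const_left) (auto simp: indexed_const_def)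
qed (auto simp: indexed_poly_ring_simps indexed_padd_const intro: indexed_pset.indexed_const)

text \<open>Makes the results on \<open>monomial_sum\<close> available when coefficients and weights
  lie in the same ring.\<close>

lemma id_ring_hom: "ring_hom_cring R R (\<lambda>x. x)"
  by (intro ring_hom_cring.intro ring_hom_cring_axioms.intro cring_axioms ring_hom_memI) auto

lemma indexed_poly_induct [consumes 1, case_names const add mult]:
  assumes "p \<in> carrier (indexed_poly_ring R V)"
    and const: "\<And>k. k \<in> carrier R \<Longrightarrow> P (indexed_const k)"
    and add: "\<And>p q. p \<in> carrier (indexed_poly_ring R V) \<Longrightarrow> q \<in> carrier (indexed_poly_ring R V) \<Longrightarrow>
      P p \<Longrightarrow> P q \<Longrightarrow> P (p \<oplus>\<^bsub>indexed_poly_ring R V\<^esub> q)"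
    and mult: "\<And>p i. p \<in> carrier (indexed_poly_ring R V) \<Longrightarrow> i \<in> V \<Longrightarrow>
      P p \<Longrightarrow> P (p \<otimes>\<^bsub>indexed_poly_ring R V\<^esub> indexed_var i)"
  shows "P p"
  using assms(1) unfolding indexed_poly_ring_simps(1)
proof induction
  case (indexed_pmult p i)
  then show ?case
    using mult[of p i] by (simp add: indexed_poly_ring_simps indexed_times_var carrier_coeff_pset)
qed (use const add in \<open>auto simp: indexed_poly_ring_simps\<close>)

lemma indexed_var_in_carrier: "i \<in> V \<Longrightarrow> indexed_var i \<in> carrier (indexed_poly_ring R V)"
  by (simp add: indexed_poly_ring_simps indexed_var_closed)

end

text \<open>The structure that a homomorphism from \<open>U_ring\<close> produces when it kills the
  relations. It is instantiated with the matrices of classes over \<open>H_ring\<close> and with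
  polynomials in a companion matrix over the ring in the listed variables.\<close>

locale cyclic_matrices = cring R for R (structure) +
  fixes n :: nat and I :: "'s set" and s1 :: 's and M :: "'s \<Rightarrow> nat \<Rightarrow> nat \<Rightarrow> 'a"
  assumes n: "1 \<le> n" and s1: "s1 \<in> I" and M: "s \<in> I \<Longrightarrow> M s \<in> mats R n"
    and commute: "s \<in> I \<Longrightarrow> t \<in> I \<Longrightarrow> v \<in> vecs R n \<Longrightarrow>
      mat_op R n (M s) (mat_op R n (M t) v) = mat_op R n (M t) (mat_op R n (M s) v)"
    and cyclic: "k \<in> {1..n} \<Longrightarrow> (mat_op R n (M s1) ^^ (k - 1)) (unit_vec R n 1) = unit_vec R n k"
begin

abbreviation W where "W \<equiv> indexed_poly_ring R I"

sublocale W: cring W by (rule cring_indexed_poly_ring)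
sublocale C: ring_hom_cring R W indexed_const by (rule const_ring_hom)
sublocale T: commuting_operators I "vecs R n" "\<lambda>s. mat_op R n (M s)"
  using M commute by unfold_locales (auto intro: mat_op_closed)

lemmas var_closed [simp, intro] = indexed_var_in_carrier[where V = I]

definition eval_vec :: "('s multiset \<Rightarrow> 'a) \<Rightarrow> nat \<Rightarrow> 'a"
  where "eval_vec f = (\<lambda>i\<in>{1..n}. mat_act R n (mat_poly R n M f) (basis_vec R 1) i)"

definition monomial_vec :: "'s multiset \<Rightarrow> nat \<Rightarrow> 'a"
  where "monomial_vec m = foldr_mset (\<lambda>s. mat_op R n (M s)) m (unit_vec R n 1)"

lemma monomial_vec_closed: "set_mset m \<subseteq> I \<Longrightarrow> i \<in> {1..n} \<Longrightarrow> monomial_vec m i \<in> carrier R"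
  unfolding monomial_vec_def using T.foldr_mset_closed[OF _ unit_vec_closed] by (rule vecsD)

text \<open>f(M) T_1 is the first column of f(M), and its i-th coordinate sums the i-th coordinates
  of the monomials applied to T_1.\<close>

lemma eval_vec_eq_monomial_sum:
  assumes f: "f \<in> carrier W" and i: "i \<in> {1..n}"
  shows "eval_vec f i = monomial_sum R R (\<lambda>x. x) (\<lambda>m. monomial_vec m i) f"
proof -
  have supp: "f m \<noteq> \<zero> \<Longrightarrow> set_mset m \<subseteq> I" for m
    using f indexed_pset_support(2) by (simp add: indexed_poly_ring_simps)
  have coeff: "f m \<in> carrier R" for m
    using f carrier_coeff_pset by (auto simp: indexed_poly_ring_simps carrier_coeff_def)
  have mono: "mat_monomial R n M m \<in> mats R n" if "f m \<noteq> \<zero>" for m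
    using M supp[OF that] by (rule mat_monomial_closed)
  have "mat_poly R n M f \<in> mats R n"
    using coeff matsD[OF mono] by (auto simp: mats_def mat_poly_def intro!: finsum_closed)
  then have "eval_vec f i = mat_poly R n M f i 1"
    using i n unfolding eval_vec_def by (simp add: mat_act_basis_vec)
  also have "\<dots> = monomial_sum R R (\<lambda>x. x) (\<lambda>m. monomial_vec m i) f"
    unfolding mat_poly_def monomial_sum_def
  proof (intro finsum_cong' refl)
    fix m assume m: "m \<in> {m. f m \<noteq> \<zero>}"
    have "mat_monomial R n M m i 1 = mat_op R n (mat_monomial R n M m) (unit_vec R n 1) i"
      using mono m i n by (intro mat_op_unit_vec[symmetric]) auto
    also have "\<dots> = monomial_vec m i"
      unfolding monomial_vec_def using M supp m
      by (subst mat_op_monomial[of I]) (auto intro: unit_vec_closed)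
    finally show "f m \<otimes> mat_monomial R n M m i 1 = f m \<otimes> monomial_vec m i"
      by simp
  qed (use coeff supp i monomial_vec_closed in auto)
  finally show ?thesis .
qed

lemma eval_vec_closed:
  assumes "f \<in> carrier W"
  shows "eval_vec f \<in> vecs R n"
proof -
  have "eval_vec f = (\<lambda>i\<in>{1..n}. eval_vec f i)"
    by (auto simp: eval_vec_def)
  moreover have "eval_vec f i \<in> carrier R" if "i \<in> {1..n}" for i
    using assms that monomial_vec_closed ring_hom_cring.monomial_sum_closed[OF id_ring_hom, of I "\<lambda>m. monomial_vec m i" f]
    by (simp add: eval_vec_eq_monomial_sum indexed_poly_ring_simps)
  ultimately show ?thesis
    by (metis restrict_in_vecs)
qed

lemma eval_vec_const:
  assumes "k \<in> carrier R" "i \<in> {1..n}"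
  shows "eval_vec (indexed_const k) i = k \<otimes> unit_vec R n 1 i"
  using assms ring_hom_cring.monomial_sum_const[OF id_ring_hom, of k "\<lambda>m. monomial_vec m i"] monomial_vec_closed[of "{#}" i]
  by (simp add: eval_vec_eq_monomial_sum[OF C.hom_closed] monomial_vec_def)

lemma eval_vec_one: "eval_vec \<one>\<^bsub>W\<^esub> = unit_vec R n 1"
proof (rule vecs_eqI)
  show "eval_vec \<one>\<^bsub>W\<^esub> i = unit_vec R n 1 i" if "i \<in> {1..n}" for i
    using eval_vec_const[of \<one> i] that vecsD[OF unit_vec_closed that] by simp
qed (auto intro: eval_vec_closed unit_vec_closed)

lemma eval_vec_add:
  assumes "f \<in> carrier W" "g \<in> carrier W" "i \<in> {1..n}"
  shows "eval_vec (f \<oplus>\<^bsub>W\<^esub> g) i = eval_vec f i \<oplus> eval_vec g i"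
proof -
  have "f \<oplus>\<^bsub>W\<^esub> g \<in> carrier W"
    using assms by simp
  then show ?thesis
    using assms monomial_vec_closed ring_hom_cring.monomial_sum_padd[OF id_ring_hom, of I "\<lambda>m. monomial_vec m i" f g]
    by (simp add: eval_vec_eq_monomial_sum indexed_poly_ring_simps)
qed

lemma eval_vec_scale:
  assumes "f \<in> carrier W" "k \<in> carrier R" "i \<in> {1..n}"
  shows "eval_vec (indexed_const k \<otimes>\<^bsub>W\<^esub> f) i = k \<otimes> eval_vec f i"
proof -
  have "indexed_const k \<otimes>\<^bsub>W\<^esub> f \<in> carrier W"
    using assms by simp
  moreover have "indexed_const k \<otimes>\<^bsub>W\<^esub> f = (\<lambda>m. k \<otimes> f m)"
    using assms by (simp add: indexed_poly_ring_simps indexed_times_const_left carrier_coeff_pset)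
  ultimately show ?thesis
    using assms monomial_vec_closed ring_hom_cring.monomial_sum_scale[OF id_ring_hom, of I "\<lambda>m. monomial_vec m i" f k]
    by (simp add: eval_vec_eq_monomial_sum indexed_poly_ring_simps)
qed

text \<open>Commutation enters here, through \<open>foldr_mset_add\<close>: the chosen order of a
  monomial may be changed so that \<open>M s\<close> acts last. Row i of \<open>M s\<close> is then
  taken out of the sum over monomials by linearity.\<close>

lemma eval_vec_mult_var:
  assumes f: "f \<in> carrier W" and s: "s \<in> I"
  shows "eval_vec (f \<otimes>\<^bsub>W\<^esub> indexed_var s) = mat_op R n (M s) (eval_vec f)"
proof (rule vecs_eqI)
  have fs: "f \<otimes>\<^bsub>W\<^esub> indexed_var s \<in> carrier W"
    using assms by simp
  then show "eval_vec (f \<otimes>\<^bsub>W\<^esub> indexed_var s) \<in> vecs R n"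
    by (rule eval_vec_closed)
  show "mat_op R n (M s) (eval_vec f) \<in> vecs R n"
    using assms by (intro mat_op_closed eval_vec_closed M)
  have f': "f \<in> indexed_pset I (carrier R)"
    using f by (simp add: indexed_poly_ring_simps)
  have eq: "f \<otimes>\<^bsub>W\<^esub> indexed_var s = indexed_pmult f s"
    using f' by (simp add: indexed_poly_ring_simps indexed_times_var carrier_coeff_pset)
  fix i assume i: "i \<in> {1..n}"
  note Mi = matsD[OF M[OF s] i]
  have "eval_vec (f \<otimes>\<^bsub>W\<^esub> indexed_var s) i = monomial_sum R R (\<lambda>x. x) (\<lambda>m. monomial_vec m i) (indexed_pmult f s)"
    using fs i unfolding eq by (rule eval_vec_eq_monomial_sum)
  also have "\<dots> = monomial_sum R R (\<lambda>x. x) (\<lambda>m. monomial_vec (add_mset s m) i) f"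
    using monomial_vec_closed i s f' by (intro ring_hom_cring.monomial_sum_pmult[OF id_ring_hom, of I]) auto
  also have "\<dots> = monomial_sum R R (\<lambda>x. x) (\<lambda>m. \<Oplus>j\<in>{1..n}. M s i j \<otimes> monomial_vec m j) f"
  proof (rule ring_hom_cring.monomial_sum_cong[OF id_ring_hom f'])
    fix m :: "'s multiset" assume m: "set_mset m \<subseteq> I"
    show "monomial_vec (add_mset s m) i = (\<Oplus>j\<in>{1..n}. M s i j \<otimes> monomial_vec m j)"
      unfolding monomial_vec_def
      using m s i by (simp add: T.foldr_mset_add unit_vec_closed mat_op_apply)
    show "(\<Oplus>j\<in>{1..n}. M s i j \<otimes> monomial_vec m j) \<in> carrier R"
      using m Mi monomial_vec_closed by (intro finsum_closed) auto
  qed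
  also have "\<dots> = (\<Oplus>j\<in>{1..n}. M s i j \<otimes> monomial_sum R R (\<lambda>x. x) (\<lambda>m. monomial_vec m j) f)"
    using Mi monomial_vec_closed by (intro ring_hom_cring.monomial_sum_linear[OF id_ring_hom f']) auto
  also have "\<dots> = (\<Oplus>j\<in>{1..n}. M s i j \<otimes> eval_vec f j)"
    using Mi vecsD[OF eval_vec_closed[OF f]] f
    by (intro finsum_cong') (auto simp: eval_vec_eq_monomial_sum)
  also have "\<dots> = mat_op R n (M s) (eval_vec f) i"
    using i by (simp add: mat_op_apply)
  finally show "eval_vec (f \<otimes>\<^bsub>W\<^esub> indexed_var s) i = mat_op R n (M s) (eval_vec f) i" .
qed

abbreviation Y where "Y \<equiv> indexed_var s1"

lemma eval_vec_Y_pow: "eval_vec (Y [^]\<^bsub>W\<^esub> k) = (mat_op R n (M s1) ^^ k) (unit_vec R n 1)"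
  by (induction k) (use s1 in \<open>simp_all add: eval_vec_one eval_vec_mult_var\<close>)

lemma eval_vec_additive: "i \<in> {1..n} \<Longrightarrow> abelian_group_hom W R (\<lambda>f. eval_vec f i)"
  by (intro abelian_group_homI W.is_abelian_group is_abelian_group group_hom.intro
      group_hom_axioms.intro W.a_group a_group)
     (auto simp: hom_def eval_vec_add intro: vecsD[OF eval_vec_closed])

lemma eval_vec_finsum:
  assumes "finite K" "f \<in> K \<rightarrow> carrier W" "i \<in> {1..n}"
  shows "eval_vec (\<Oplus>\<^bsub>W\<^esub>k\<in>K. f k) i = (\<Oplus>k\<in>K. eval_vec (f k) i)"
proof -
  interpret E: abelian_group_hom W R "\<lambda>f. eval_vec f i"
    using assms(3) by (rule eval_vec_additive)
  show ?thesis
    using assms(1,2)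
    by induction (auto simp: eval_vec_add assms(3) Pi_iff vecsD[OF eval_vec_closed])
qed

text \<open>The image of the vector c under the base change of beta_1.\<close>

definition Y_comb :: "(nat \<Rightarrow> 'a) \<Rightarrow> 's multiset \<Rightarrow> 'a"
  where "Y_comb c = (\<Oplus>\<^bsub>W\<^esub>k\<in>{1..n}. indexed_const (c k) \<otimes>\<^bsub>W\<^esub> Y [^]\<^bsub>W\<^esub> (k - 1))"

lemma Y_closed [simp, intro]: "Y \<in> carrier W"
  using s1 by simp

lemma Y_comb_closed [intro]: "c \<in> {1..n} \<rightarrow> carrier R \<Longrightarrow> Y_comb c \<in> carrier W"
  unfolding Y_comb_def by (intro W.finsum_closed) auto

text \<open>Evaluation is a left inverse of beta_1, because Y^(k-1) goes to the (k-1)-st power of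
  \<open>M s1\<close> applied to T_1, which is T_k.\<close>

lemma eval_vec_Y_comb:
  assumes "c \<in> {1..n} \<rightarrow> carrier R" "i \<in> {1..n}"
  shows "eval_vec (Y_comb c) i = c i"
proof -
  have "eval_vec (Y_comb c) i = (\<Oplus>k\<in>{1..n}. eval_vec (indexed_const (c k) \<otimes>\<^bsub>W\<^esub> Y [^]\<^bsub>W\<^esub> (k - 1)) i)"
    unfolding Y_comb_def using assms by (intro eval_vec_finsum) auto
  also have "\<dots> = (\<Oplus>k\<in>{1..n}. c k \<otimes> unit_vec R n k i)"
  proof (intro finsum_cong' refl)
    fix k assume k: "k \<in> {1..n}"
    then have "eval_vec (indexed_const (c k) \<otimes>\<^bsub>W\<^esub> Y [^]\<^bsub>W\<^esub> (k - 1)) i = c k \<otimes> eval_vec (Y [^]\<^bsub>W\<^esub> (k - 1)) i"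
      using assms by (intro eval_vec_scale) auto
    with k show "eval_vec (indexed_const (c k) \<otimes>\<^bsub>W\<^esub> Y [^]\<^bsub>W\<^esub> (k - 1)) i = c k \<otimes> unit_vec R n k i"
      by (simp only: eval_vec_Y_pow cyclic)
  qed (use assms vecsD[OF unit_vec_closed] in auto)
  also have "\<dots> = c i"
    using assms by (intro unit_vec_expansion) auto
  finally show ?thesis .
qed

section \<open>The annihilator of the cyclic vector\<close>

definition ann :: "('s multiset \<Rightarrow> 'a) set"
  where "ann = {f \<in> carrier W. \<forall>i\<in>{1..n}. eval_vec f i = \<zero>}"

lemma ann_iff: "f \<in> ann \<longleftrightarrow> f \<in> carrier W \<and> eval_vec f = (\<lambda>i\<in>{1..n}. \<zero>)"
proof -
  have "(\<forall>i\<in>{1..n}. eval_vec f i = \<zero>) \<longleftrightarrow> eval_vec f = (\<lambda>i\<in>{1..n}. \<zero>)"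
    by (auto simp: eval_vec_def restrict_def fun_eq_iff)
  then show ?thesis
    by (auto simp: ann_def)
qed

text \<open>Induction on the multiplier: a constant scales the vector f(M) T_1 = 0, and a variable
  applies a matrix to it, so it stays zero.\<close>

lemma ann_mult_closed:
  assumes f: "f \<in> ann" and g: "g \<in> carrier W"
  shows "f \<otimes>\<^bsub>W\<^esub> g \<in> ann"
  using g
proof (induction g rule: indexed_poly_induct)
  case (const k)
  have "eval_vec (f \<otimes>\<^bsub>W\<^esub> indexed_const k) i = \<zero>" if "i \<in> {1..n}" for i
    using f const that by (subst W.m_comm) (auto simp: ann_def eval_vec_scale)
  then show ?case
    using f const by (auto simp: ann_def)
next
  case (add p q)
  then show ?case
    using f by (auto simp: ann_def W.r_distr eval_vec_add)
next
  case (mult p s)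
  have "eval_vec (f \<otimes>\<^bsub>W\<^esub> p \<otimes>\<^bsub>W\<^esub> indexed_var s) = mat_op R n (M s) (\<lambda>i\<in>{1..n}. \<zero>)"
    using f mult by (subst eval_vec_mult_var) (auto simp: ann_iff)
  also have "\<dots> = (\<lambda>i\<in>{1..n}. \<zero>)"
  proof -
    have "M s i j \<otimes> \<zero> = \<zero>" if "i \<in> {1..n}" "j \<in> {1..n}" for i j
      using matsD[OF M[OF mult(2)] that] by simp
    then show ?thesis
      unfolding mat_op_def mat_act_def by (intro restrict_ext add.finprod_one_eqI) auto
  qed
  finally show ?case
    using f mult by (auto simp: ann_iff W.m_assoc)
qed

lemma ideal_ann: "ideal ann W"
proof (rule idealI)
  show "subgroup ann (add_monoid W)"
  proof (rule W.add.subgroupI)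
    have "\<zero>\<^bsub>W\<^esub> \<in> ann"
      using abelian_group_hom.hom_zero[OF eval_vec_additive] by (auto simp: ann_def)
    then show "ann \<noteq> {}" by auto
    show "\<ominus>\<^bsub>W\<^esub> f \<in> ann" if "f \<in> ann" for f
      using that abelian_group_hom.hom_a_inv[OF eval_vec_additive, of _ f] by (auto simp: ann_def)
  qed (auto simp: ann_def eval_vec_add)
  show "f \<otimes>\<^bsub>W\<^esub> g \<in> ann" if "f \<in> ann" "g \<in> carrier W" for f g
    using that by (rule ann_mult_closed)
  show "g \<otimes>\<^bsub>W\<^esub> f \<in> ann" if "f \<in> ann" "g \<in> carrier W" for f g
    using ann_mult_closed[OF that] that by (subst W.m_comm) (auto simp: ann_def)
qed (rule W.ring_axioms)

definition ann_gens :: "('s multiset \<Rightarrow> 'a) set"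
  where "ann_gens = {Y [^]\<^bsub>W\<^esub> n \<ominus>\<^bsub>W\<^esub> Y_comb (\<lambda>i. M s1 i n)}
    \<union> {indexed_var s \<ominus>\<^bsub>W\<^esub> Y_comb (\<lambda>i. M s i 1) | s. s \<in> I - {s1}}"

lemma M_column: "s \<in> I \<Longrightarrow> j \<in> {1..n} \<Longrightarrow> (\<lambda>i. M s i j) \<in> {1..n} \<rightarrow> carrier R"
  using matsD[OF M] by auto

lemma eval_vec_diff:
  assumes "f \<in> carrier W" "g \<in> carrier W" "i \<in> {1..n}"
  shows "eval_vec (f \<ominus>\<^bsub>W\<^esub> g) i = eval_vec f i \<ominus> eval_vec g i"
  using assms abelian_group_hom.hom_a_inv[OF eval_vec_additive, of i g]
  by (simp add: a_minus_def eval_vec_add)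

lemma diff_Y_comb_in_ann:
  assumes "f \<in> carrier W" "c \<in> {1..n} \<rightarrow> carrier R" "\<And>i. i \<in> {1..n} \<Longrightarrow> eval_vec f i = c i"
  shows "f \<ominus>\<^bsub>W\<^esub> Y_comb c \<in> ann"
  using assms by (auto simp: ann_def eval_vec_diff Y_comb_closed eval_vec_Y_comb Pi_iff)

text \<open>The columns in the generators are explained by Y^n T_1 = \<open>M s1\<close> T_n, which
  is column n of \<open>M s1\<close>, and by Y_s T_1 = \<open>M s\<close> T_1, which is column 1 of
  \<open>M s\<close>.\<close>

lemma ann_gens_subset: "ann_gens \<subseteq> ann"
proof -
  have "eval_vec (Y [^]\<^bsub>W\<^esub> n) i = M s1 i n" if i: "i \<in> {1..n}" for i
  proof -
    \<comment> \<open>Splits off one factor of Y^n; the remaining n - 1 factors carry T_1 to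
      T_n.\<close>
    obtain k where k: "n = Suc k"
      using n by (cases n) auto
    have "eval_vec (Y [^]\<^bsub>W\<^esub> n) = mat_op R n (M s1) (unit_vec R n n)"
      using cyclic[of n] n unfolding eval_vec_Y_pow by (simp add: k)
    then show ?thesis
      using i n s1 by (simp add: mat_op_unit_vec M)
  qed
  moreover have "eval_vec (indexed_var s) i = M s i 1" if "i \<in> {1..n}" "s \<in> I" for s i
    using eval_vec_mult_var[of "\<one>\<^bsub>W\<^esub>" s] that n by (simp add: eval_vec_one mat_op_unit_vec M)
  ultimately show ?thesis
    using n s1 by (auto simp: ann_gens_def intro!: diff_Y_comb_in_ann[OF _ M_column])
qed

lemma Y_comb_add:
  assumes "c \<in> {1..n} \<rightarrow> carrier R" "d \<in> {1..n} \<rightarrow> carrier R"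
  shows "Y_comb (\<lambda>i. c i \<oplus> d i) = Y_comb c \<oplus>\<^bsub>W\<^esub> Y_comb d"
proof -
  have "Y_comb (\<lambda>i. c i \<oplus> d i) = (\<Oplus>\<^bsub>W\<^esub>k\<in>{1..n}. indexed_const (c k) \<otimes>\<^bsub>W\<^esub> Y [^]\<^bsub>W\<^esub> (k - 1)
      \<oplus>\<^bsub>W\<^esub> indexed_const (d k) \<otimes>\<^bsub>W\<^esub> Y [^]\<^bsub>W\<^esub> (k - 1))"
    unfolding Y_comb_def using assms by (intro W.finsum_cong' refl) (auto simp: Pi_iff W.l_distr)
  also have "\<dots> = Y_comb c \<oplus>\<^bsub>W\<^esub> Y_comb d"
    unfolding Y_comb_def using assms by (intro W.finsum_addf) auto
  finally show ?thesis .
qed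

lemma Y_comb_scale:
  assumes "c \<in> {1..n} \<rightarrow> carrier R" "k \<in> carrier R"
  shows "Y_comb (\<lambda>i. k \<otimes> c i) = indexed_const k \<otimes>\<^bsub>W\<^esub> Y_comb c"
  unfolding Y_comb_def
  using assms
  by (subst W.finsum_rdistr) (auto intro!: W.finsum_cong' simp: Pi_iff W.m_assoc)

text \<open>Coefficients are counted from 1, so the exponent k belongs to the index
  \<open>Suc k\<close>.\<close>

lemma Y_comb_unit:
  assumes "k < n"
  shows "Y_comb (\<lambda>i. if i = Suc k then \<one> else \<zero>) = Y [^]\<^bsub>W\<^esub> k"
proof -
  have "Y_comb (\<lambda>i. if i = Suc k then \<one> else \<zero>)
    = (\<Oplus>\<^bsub>W\<^esub>i\<in>{1..n}. if i = Suc k then Y [^]\<^bsub>W\<^esub> (i - 1) else \<zero>\<^bsub>W\<^esub>)"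
    unfolding Y_comb_def by (intro W.finsum_cong') auto
  also have "\<dots> = Y [^]\<^bsub>W\<^esub> k"
    using assms W.add.finprod_singleton_swap[of "Suc k" "{1..n}" "\<lambda>i. Y [^]\<^bsub>W\<^esub> (i - 1)"] by auto
  finally show ?thesis .
qed

section \<open>Reduction modulo the generators to degree below n in Y\<close>

context
  fixes J
  assumes J: "J = Idl\<^bsub>W\<^esub> ann_gens"
begin

lemma ann_gens_carrier: "ann_gens \<subseteq> carrier W"
  using ann_gens_subset by (auto simp: ann_def)

lemma ideal_J: "ideal J W"
  unfolding J by (rule W.genideal_ideal[OF ann_gens_carrier])

interpretation Q: ring_hom_cring W "W Quot J" "\<lambda>f. J +>\<^bsub>W\<^esub> f"
  using ideal.rcos_ring_hom_cring[OF ideal_J W.cring_axioms] .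

text \<open>Congruence is phrased by equality of cosets, so that the quotient homomorphism carries
  out the arithmetic of congruences.\<close>

definition reducible :: "('s multiset \<Rightarrow> 'a) set"
  where "reducible = {f \<in> carrier W. \<exists>c \<in> {1..n} \<rightarrow> carrier R. J +>\<^bsub>W\<^esub> f = J +>\<^bsub>W\<^esub> Y_comb c}"

lemma reducible_cong:
  "f \<in> carrier W \<Longrightarrow> g \<in> reducible \<Longrightarrow> J +>\<^bsub>W\<^esub> f = J +>\<^bsub>W\<^esub> g \<Longrightarrow> f \<in> reducible"
  by (auto simp: reducible_def)

lemma reducible_carrier: "f \<in> reducible \<Longrightarrow> f \<in> carrier W"
  by (auto simp: reducible_def)

lemma reducible_Y_comb: "c \<in> {1..n} \<rightarrow> carrier R \<Longrightarrow> Y_comb c \<in> reducible"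
  by (auto simp: reducible_def)

lemma reducible_add:
  assumes "f \<in> reducible" "g \<in> reducible"
  shows "f \<oplus>\<^bsub>W\<^esub> g \<in> reducible"
proof -
  obtain c d where cd: "c \<in> {1..n} \<rightarrow> carrier R" "J +>\<^bsub>W\<^esub> f = J +>\<^bsub>W\<^esub> Y_comb c"
      "d \<in> {1..n} \<rightarrow> carrier R" "J +>\<^bsub>W\<^esub> g = J +>\<^bsub>W\<^esub> Y_comb d"
    using assms by (auto simp: reducible_def)
  have "J +>\<^bsub>W\<^esub> (f \<oplus>\<^bsub>W\<^esub> g) = J +>\<^bsub>W\<^esub> Y_comb (\<lambda>i. c i \<oplus> d i)"
    using cd assms by (simp add: Y_comb_add Y_comb_closed reducible_carrier)
  with cd assms show ?thesis
    by (intro reducible_cong[OF _ reducible_Y_comb]) (auto simp: reducible_carrier Pi_iff)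
qed

lemma reducible_scale:
  assumes "f \<in> reducible" "k \<in> carrier R"
  shows "indexed_const k \<otimes>\<^bsub>W\<^esub> f \<in> reducible"
proof -
  obtain c where c: "c \<in> {1..n} \<rightarrow> carrier R" "J +>\<^bsub>W\<^esub> f = J +>\<^bsub>W\<^esub> Y_comb c"
    using assms by (auto simp: reducible_def)
  have "J +>\<^bsub>W\<^esub> (indexed_const k \<otimes>\<^bsub>W\<^esub> f) = J +>\<^bsub>W\<^esub> Y_comb (\<lambda>i. k \<otimes> c i)"
    using c assms by (simp add: Y_comb_scale Y_comb_closed reducible_carrier)
  with c assms show ?thesis
    by (intro reducible_cong[OF _ reducible_Y_comb]) (auto simp: reducible_carrier Pi_iff)
qed

lemma reducible_Y_pow_less: "k < n \<Longrightarrow> Y [^]\<^bsub>W\<^esub> k \<in> reducible"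
  using reducible_Y_comb[of "\<lambda>i. if i = Suc k then \<one> else \<zero>"] by (simp add: Y_comb_unit)

lemma reducible_finsum:
  assumes "finite K" "f \<in> K \<rightarrow> reducible"
  shows "(\<Oplus>\<^bsub>W\<^esub>k\<in>K. f k) \<in> reducible"
  using assms
proof induction
  case empty
  \<comment> \<open>The empty sum is written as zero times Y^0, and Y^0 is reducible because 0 <
    n.\<close>
  then show ?case
    using reducible_scale[OF reducible_Y_pow_less[of 0] zero_closed] n by simp
next
  case (insert k K)
  then have "f \<in> K \<rightarrow> carrier W" "f k \<in> carrier W"
    using reducible_carrier by auto
  with insert show ?case
    by (simp add: reducible_add)
qed

lemma J_cong: "f \<ominus>\<^bsub>W\<^esub> g \<in> ann_gens \<Longrightarrow> f \<in> carrier W \<Longrightarrow> g \<in> carrier W \<Longrightarrow> J +>\<^bsub>W\<^esub> f = J +>\<^bsub>W\<^esub> g"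
  using W.quotient_eq_iff_same_a_r_cos[OF ideal_J, of f g] W.genideal_self[OF ann_gens_carrier]
  by (auto simp: J)

text \<open>Exponent n is the only one beyond the basis, and the first generator rewrites it.
  Nothing higher arises when Y multiplies a combination of Y^0, ..., Y^(n-1).\<close>

lemma reducible_Y_pow: "k \<le> n \<Longrightarrow> Y [^]\<^bsub>W\<^esub> k \<in> reducible"
proof (cases "k = n")
  case True
  have c: "(\<lambda>i. M s1 i n) \<in> {1..n} \<rightarrow> carrier R"
    using s1 n by (intro M_column) auto
  have "J +>\<^bsub>W\<^esub> Y [^]\<^bsub>W\<^esub> n = J +>\<^bsub>W\<^esub> Y_comb (\<lambda>i. M s1 i n)"
    using c by (intro J_cong) (auto simp: ann_gens_def)
  then show ?thesis
    using reducible_cong[OF _ reducible_Y_comb[OF c]] True by auto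
qed (simp add: reducible_Y_pow_less)

lemma reducible_mult_Y:
  assumes "f \<in> reducible"
  shows "Y \<otimes>\<^bsub>W\<^esub> f \<in> reducible"
proof -
  obtain c where c: "c \<in> {1..n} \<rightarrow> carrier R" "J +>\<^bsub>W\<^esub> f = J +>\<^bsub>W\<^esub> Y_comb c"
    using assms by (auto simp: reducible_def)
  have "Y \<otimes>\<^bsub>W\<^esub> Y_comb c = (\<Oplus>\<^bsub>W\<^esub>k\<in>{1..n}. Y \<otimes>\<^bsub>W\<^esub> (indexed_const (c k) \<otimes>\<^bsub>W\<^esub> Y [^]\<^bsub>W\<^esub> (k - 1)))"
    unfolding Y_comb_def using c by (intro W.finsum_rdistr) auto
  also have "\<dots> = (\<Oplus>\<^bsub>W\<^esub>k\<in>{1..n}. indexed_const (c k) \<otimes>\<^bsub>W\<^esub> Y [^]\<^bsub>W\<^esub> k)"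
  proof (intro W.finsum_cong' refl)
    fix k assume k: "k \<in> {1..n}"
    then obtain l where l: "k = Suc l"
      by (cases k) auto
    have ck: "c (Suc l) \<in> carrier R"
      using k c by (auto simp: l)
    show "Y \<otimes>\<^bsub>W\<^esub> (indexed_const (c k) \<otimes>\<^bsub>W\<^esub> Y [^]\<^bsub>W\<^esub> (k - 1)) = indexed_const (c k) \<otimes>\<^bsub>W\<^esub> Y [^]\<^bsub>W\<^esub> k"
      using ck W.m_lcomm[of Y "indexed_const (c k)" "Y [^]\<^bsub>W\<^esub> l"] W.m_comm[of Y "Y [^]\<^bsub>W\<^esub> l"]
      by (simp add: l)
  qed (use c in auto)
  also have "\<dots> \<in> reducible"
    using c by (intro reducible_finsum) (auto intro!: reducible_scale reducible_Y_pow)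
  finally have red: "Y \<otimes>\<^bsub>W\<^esub> Y_comb c \<in> reducible" .
  have fW: "f \<in> carrier W"
    using assms by (rule reducible_carrier)
  have "J +>\<^bsub>W\<^esub> (Y \<otimes>\<^bsub>W\<^esub> f) = J +>\<^bsub>W\<^esub> (Y \<otimes>\<^bsub>W\<^esub> Y_comb c)"
    unfolding Q.hom_mult[OF Y_closed fW] Q.hom_mult[OF Y_closed Y_comb_closed[OF c(1)]] c(2) ..
  then show ?thesis
    by (rule reducible_cong[OF W.m_closed[OF Y_closed fW] red])
qed

lemma reducible_mult_Y_pow: "f \<in> reducible \<Longrightarrow> Y [^]\<^bsub>W\<^esub> (k :: nat) \<otimes>\<^bsub>W\<^esub> f \<in> reducible"
proof (induction k arbitrary: f)
  case (Suc k)
  have "Y [^]\<^bsub>W\<^esub> Suc k \<otimes>\<^bsub>W\<^esub> f = Y [^]\<^bsub>W\<^esub> k \<otimes>\<^bsub>W\<^esub> (Y \<otimes>\<^bsub>W\<^esub> f)"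
    using reducible_carrier[OF Suc.prems] by (simp add: W.m_assoc)
  then show ?case
    using Suc.IH[OF reducible_mult_Y[OF Suc.prems]] by simp
qed (simp add: reducible_carrier)

lemma reducible_mult_Y_comb:
  assumes f: "f \<in> reducible" and c: "c \<in> {1..n} \<rightarrow> carrier R"
  shows "Y_comb c \<otimes>\<^bsub>W\<^esub> f \<in> reducible"
proof -
  have "Y_comb c \<otimes>\<^bsub>W\<^esub> f = (\<Oplus>\<^bsub>W\<^esub>k\<in>{1..n}. indexed_const (c k) \<otimes>\<^bsub>W\<^esub> Y [^]\<^bsub>W\<^esub> (k - 1) \<otimes>\<^bsub>W\<^esub> f)"
    unfolding Y_comb_def using c f by (intro W.finsum_ldistr) (auto simp: reducible_carrier)
  also have "\<dots> = (\<Oplus>\<^bsub>W\<^esub>k\<in>{1..n}. indexed_const (c k) \<otimes>\<^bsub>W\<^esub> (Y [^]\<^bsub>W\<^esub> (k - 1) \<otimes>\<^bsub>W\<^esub> f))"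
    using c f by (intro W.finsum_cong') (auto simp: reducible_carrier Pi_iff W.m_assoc)
  also have "\<dots> \<in> reducible"
    using c f by (intro reducible_finsum) (auto intro!: reducible_scale reducible_mult_Y_pow)
  finally show ?thesis .
qed

text \<open>Modulo the generators a variable other than Y is a combination of powers of Y, so the
  product reduces to repeated multiplication by Y.\<close>

lemma reducible_mult_var:
  assumes f: "f \<in> reducible" and s: "s \<in> I"
  shows "indexed_var s \<otimes>\<^bsub>W\<^esub> f \<in> reducible"
proof (cases "s = s1")
  case False
  have c: "(\<lambda>i. M s i 1) \<in> {1..n} \<rightarrow> carrier R"
    using s n by (intro M_column) auto
  have "J +>\<^bsub>W\<^esub> indexed_var s = J +>\<^bsub>W\<^esub> Y_comb (\<lambda>i. M s i 1)"
    using c s False by (intro J_cong) (auto simp: ann_gens_def)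
  then show ?thesis
    using c s f
    by (intro reducible_cong[OF _ reducible_mult_Y_comb[OF f c]]) (auto simp: reducible_carrier Y_comb_closed)
qed (simp add: f reducible_mult_Y)

lemma carrier_reducible:
  assumes "f \<in> carrier W"
  shows "f \<in> reducible"
  using assms
proof (induction f rule: indexed_poly_induct)
  case (const k)
  then show ?case
    using reducible_scale[OF reducible_Y_pow[of 0], of k] by simp
next
  case (add f g)
  then show ?case by (simp add: reducible_add)
next
  case (mult f s)
  then show ?case
    using reducible_mult_var[of f s] by (subst W.m_comm) auto
qed

lemma ann_subset_J: "ann \<subseteq> J"
proof
  fix f assume f: "f \<in> ann"
  then have fW: "f \<in> carrier W"
    by (simp add: ann_def)
  then obtain c where c: "c \<in> {1..n} \<rightarrow> carrier R" "J +>\<^bsub>W\<^esub> f = J +>\<^bsub>W\<^esub> Y_comb c"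
    using carrier_reducible[OF fW] unfolding reducible_def by blast
  then have diff: "f \<ominus>\<^bsub>W\<^esub> Y_comb c \<in> J"
    using W.quotient_eq_iff_same_a_r_cos[OF ideal_J fW Y_comb_closed[OF c(1)]] by blast
  moreover have "J \<subseteq> ann"
    unfolding J using ideal_ann ann_gens_subset by (rule W.genideal_minimal)
  ultimately have "f \<ominus>\<^bsub>W\<^esub> Y_comb c \<in> ann"
    by (rule rev_subsetD)
  then have "c i = \<zero>" if i: "i \<in> {1..n}" for i
  proof -
    have ci: "c i \<in> carrier R"
      using c(1) i by (rule funcset_mem)
    have "\<zero> = eval_vec (f \<ominus>\<^bsub>W\<^esub> Y_comb c) i"
      using \<open>f \<ominus>\<^bsub>W\<^esub> Y_comb c \<in> ann\<close> i by (simp add: ann_def)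
    also have "\<dots> = eval_vec f i \<ominus> eval_vec (Y_comb c) i"
      using fW c(1) i by (intro eval_vec_diff) auto
    also have "\<dots> = \<zero> \<ominus> c i"
      using f i c(1) by (simp add: ann_def eval_vec_Y_comb)
    finally show ?thesis
      using ci by (metis r_right_minus_eq zero_closed)
  qed
  then have "Y_comb c = \<zero>\<^bsub>W\<^esub>"
    unfolding Y_comb_def by (intro W.add.finprod_one_eqI) auto
  then have "f \<ominus>\<^bsub>W\<^esub> Y_comb c = f"
    using fW by (simp add: a_minus_def)
  with diff show "f \<in> J"
    by (simp only:)
qed

end

theorem ann_eq_genideal: "ann = Idl\<^bsub>W\<^esub> ann_gens"
proof
  show "ann \<subseteq> Idl\<^bsub>W\<^esub> ann_gens"
    by (rule ann_subset_J[OF refl])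
  show "Idl\<^bsub>W\<^esub> ann_gens \<subseteq> ann"
    using ideal_ann ann_gens_subset by (rule W.genideal_minimal)
qed

end

section \<open>Companion matrices\<close>

definition companion :: "('a, 'm) ring_scheme \<Rightarrow> nat \<Rightarrow> (nat \<Rightarrow> 'a) \<Rightarrow> nat \<Rightarrow> nat \<Rightarrow> 'a"
  where "companion R n u = (\<lambda>i j. if j = n then u i else if i = Suc j then \<one>\<^bsub>R\<^esub> else \<zero>\<^bsub>R\<^esub>)"

text \<open>The value at C of the polynomial with coefficient vector a, where \<open>a k\<close>
  belongs to exponent k - 1, as in \<open>Y_comb\<close>.\<close>

definition mat_comb :: "('a, 'm) ring_scheme \<Rightarrow> nat \<Rightarrow> (nat \<Rightarrow> nat \<Rightarrow> 'a) \<Rightarrow> (nat \<Rightarrow> 'a) \<Rightarrow> nat \<Rightarrow> nat \<Rightarrow> 'a"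
  where "mat_comb R n C a = (\<lambda>i j. \<Oplus>\<^bsub>R\<^esub>k\<in>{1..n}. a k \<otimes>\<^bsub>R\<^esub> mat_pow R n C (k - 1) i j)"

context cring
begin

lemma companion_closed: "u \<in> {1..n} \<rightarrow> carrier R \<Longrightarrow> companion R n u \<in> mats R n"
  by (auto simp: mats_def companion_def)

lemma mat_op_companion_unit_vec:
  assumes "u \<in> {1..n} \<rightarrow> carrier R" "1 \<le> k" "k < n"
  shows "mat_op R n (companion R n u) (unit_vec R n k) = unit_vec R n (Suc k)"
proof (rule vecs_eqI)
  fix i assume i: "i \<in> {1..n}"
  then show "mat_op R n (companion R n u) (unit_vec R n k) i = unit_vec R n (Suc k) i"
    using assms by (subst mat_op_unit_vec[OF companion_closed]) (auto simp: companion_def unit_vec_def basis_vec_def)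
qed (use assms in \<open>auto intro: mat_op_closed companion_closed unit_vec_closed\<close>)

lemma companion_pow_unit_vec:
  assumes "u \<in> {1..n} \<rightarrow> carrier R" "k < n"
  shows "(mat_op R n (companion R n u) ^^ k) (unit_vec R n 1) = unit_vec R n (Suc k)"
  using assms(2) by (induction k) (auto simp: mat_op_companion_unit_vec[OF assms(1)] One_nat_def)

lemma mat_comb_closed: "C \<in> mats R n \<Longrightarrow> a \<in> {1..n} \<rightarrow> carrier R \<Longrightarrow> mat_comb R n C a \<in> mats R n"
  using matsD[OF mat_pow_closed[of C n]]
  by (auto simp: mats_def mat_comb_def Pi_iff intro!: finsum_closed)

lemma mat_op_mat_comb:
  assumes C: "C \<in> mats R n" and a: "a \<in> {1..n} \<rightarrow> carrier R" and v: "v \<in> vecs R n"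
  shows "mat_op R n (mat_comb R n C a) v = (\<lambda>i\<in>{1..n}. \<Oplus>k\<in>{1..n}. a k \<otimes> (mat_op R n C ^^ (k - 1)) v i)"
proof (rule vecs_eqI)
  have P: "i \<in> {1..n} \<Longrightarrow> j \<in> {1..n} \<Longrightarrow> mat_pow R n C k i j \<in> carrier R" for k i j
    using mat_pow_closed[OF C] by (rule matsD)
  have ak: "k \<in> {1..n} \<Longrightarrow> a k \<in> carrier R" for k
    using a by blast
  have Cv: "i \<in> {1..n} \<Longrightarrow> (mat_op R n C ^^ k) v i \<in> carrier R" for k i
    using mat_op_pow_closed[OF C v] by (rule vecsD)
  show "mat_op R n (mat_comb R n C a) v \<in> vecs R n"
    using assms by (intro mat_op_closed mat_comb_closed)
  show "(\<lambda>i\<in>{1..n}. \<Oplus>k\<in>{1..n}. a k \<otimes> (mat_op R n C ^^ (k - 1)) v i) \<in> vecs R n"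
    using ak Cv by (intro restrict_in_vecs finsum_closed) auto
  fix i assume i: "i \<in> {1..n}"
  have "mat_op R n (mat_comb R n C a) v i
      = (\<Oplus>j\<in>{1..n}. \<Oplus>k\<in>{1..n}. a k \<otimes> (mat_pow R n C (k - 1) i j \<otimes> v j))"
    unfolding mat_op_apply[OF i] mat_comb_def
  proof (intro finsum_cong' refl)
    fix j assume j: "j \<in> {1..n}"
    have "(\<Oplus>k\<in>{1..n}. a k \<otimes> mat_pow R n C (k - 1) i j) \<otimes> v j
        = (\<Oplus>k\<in>{1..n}. a k \<otimes> mat_pow R n C (k - 1) i j \<otimes> v j)"
      using i j ak P vecsD[OF v] by (intro finsum_ldistr) auto
    also have "\<dots> = (\<Oplus>k\<in>{1..n}. a k \<otimes> (mat_pow R n C (k - 1) i j \<otimes> v j))"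
      using i j ak P vecsD[OF v] by (intro finsum_cong') (auto simp: m_assoc)
    finally show "(\<Oplus>k\<in>{1..n}. a k \<otimes> mat_pow R n C (k - 1) i j) \<otimes> v j
      = (\<Oplus>k\<in>{1..n}. a k \<otimes> (mat_pow R n C (k - 1) i j \<otimes> v j))" .
  qed (use i ak P vecsD[OF v] in \<open>auto intro!: finsum_closed\<close>)
  also have "\<dots> = (\<Oplus>k\<in>{1..n}. \<Oplus>j\<in>{1..n}. a k \<otimes> (mat_pow R n C (k - 1) i j \<otimes> v j))"
    using i ak P vecsD[OF v] by (intro finsum_swap) auto
  also have "\<dots> = (\<Oplus>k\<in>{1..n}. a k \<otimes> (mat_op R n C ^^ (k - 1)) v i)"
  proof (intro finsum_cong' refl)
    fix k assume k: "k \<in> {1..n}"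
    have eq: "(mat_op R n C ^^ (k - 1)) v i = (\<Oplus>j\<in>{1..n}. mat_pow R n C (k - 1) i j \<otimes> v j)"
      unfolding mat_op_pow[OF C v, symmetric] by (rule mat_op_apply[OF i])
    show "(\<Oplus>j\<in>{1..n}. a k \<otimes> (mat_pow R n C (k - 1) i j \<otimes> v j)) = a k \<otimes> (mat_op R n C ^^ (k - 1)) v i"
      unfolding eq using i k ak P vecsD[OF v] by (intro finsum_rdistr[symmetric]) auto
  qed (use i ak Cv in auto)
  finally show "mat_op R n (mat_comb R n C a) v i
      = (\<lambda>i\<in>{1..n}. \<Oplus>k\<in>{1..n}. a k \<otimes> (mat_op R n C ^^ (k - 1)) v i) i"
    using i by simp
qed

lemma mat_op_pow_commute:
  assumes "C \<in> mats R n" "v \<in> vecs R n"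
    and "\<And>v. v \<in> vecs R n \<Longrightarrow> mat_op R n N (mat_op R n C v) = mat_op R n C (mat_op R n N v)"
  shows "mat_op R n N ((mat_op R n C ^^ k) v) = (mat_op R n C ^^ k) (mat_op R n N v)"
  by (induction k) (use assms in \<open>simp_all add: mat_op_pow_closed\<close>)

text \<open>A matrix that commutes with C commutes with each power of C, hence with their
  combinations. Applied first to N = C, and then to N another combination, whose commutation with C
  is the first application.\<close>

lemma mat_comb_commute:
  assumes C: "C \<in> mats R n" and a: "a \<in> {1..n} \<rightarrow> carrier R" and N: "N \<in> mats R n"
    and comm: "\<And>v. v \<in> vecs R n \<Longrightarrow> mat_op R n N (mat_op R n C v) = mat_op R n C (mat_op R n N v)"
    and v: "v \<in> vecs R n"
  shows "mat_op R n N (mat_op R n (mat_comb R n C a) v) = mat_op R n (mat_comb R n C a) (mat_op R n N v)"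
proof -
  have "mat_op R n N (mat_op R n (mat_comb R n C a) v)
      = (\<lambda>i\<in>{1..n}. \<Oplus>k\<in>{1..n}. a k \<otimes> mat_op R n N ((mat_op R n C ^^ (k - 1)) v) i)"
    unfolding mat_op_mat_comb[OF C a v]
    using mat_op_pow_closed[OF C v] by (intro mat_op_linear[OF N _ a]) auto
  also have "\<dots> = mat_op R n (mat_comb R n C a) (mat_op R n N v)"
    by (simp only: mat_op_pow_commute[OF C v comm] mat_op_mat_comb[OF C a mat_op_closed[OF N v]])
  finally show ?thesis .
qed

text \<open>The powers of a companion matrix carry T_1 through the basis, so a polynomial in it
  sends T_1 to its own coefficient vector. This is why the retraction fixes the listed variables in
  first columns.\<close>

lemma mat_comb_companion_column:
  assumes u: "u \<in> {1..n} \<rightarrow> carrier R" and a: "a \<in> {1..n} \<rightarrow> carrier R" and i: "i \<in> {1..n}"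
  shows "mat_comb R n (companion R n u) a i 1 = a i"
proof -
  let ?C = "companion R n u"
  have C: "?C \<in> mats R n"
    using u by (rule companion_closed)
  have "1 \<in> {1..n}"
    using i by auto
  then have "mat_comb R n ?C a i 1 = mat_op R n (mat_comb R n ?C a) (unit_vec R n 1) i"
    using i C a by (intro mat_op_unit_vec[symmetric] mat_comb_closed)
  also have "\<dots> = (\<Oplus>k\<in>{1..n}. a k \<otimes> (mat_op R n ?C ^^ (k - 1)) (unit_vec R n 1) i)"
    using i by (subst mat_op_mat_comb[OF C a unit_vec_closed]) simp
  also have "\<dots> = (\<Oplus>k\<in>{1..n}. a k \<otimes> unit_vec R n k i)"
  proof (intro finsum_cong' refl)
    fix k assume k: "k \<in> {1..n}"
    then have "(mat_op R n ?C ^^ (k - 1)) (unit_vec R n 1) = unit_vec R n k"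
      using companion_pow_unit_vec[OF u, of "k - 1"] by auto
    then show "a k \<otimes> (mat_op R n ?C ^^ (k - 1)) (unit_vec R n 1) i = a k \<otimes> unit_vec R n k i"
      by simp
  qed (use a i vecsD[OF unit_vec_closed] in auto)
  also have "\<dots> = a i"
    using i a by (rule unit_vec_expansion)
  finally show ?thesis .
qed

text \<open>All the matrices are polynomials in one companion matrix and therefore commute;
  cyclicity is the shift from T_j to T_(j+1). The vectors \<open>u\<close> and \<open>a s\<close>
  are free parameters.\<close>

theorem cyclic_matrices_companion:
  fixes I :: "'s set"
  assumes n: "1 \<le> n" and s1: "s1 \<in> I" and u: "u \<in> {1..n} \<rightarrow> carrier R"
    and a: "\<And>s. s \<in> I - {s1} \<Longrightarrow> a s \<in> {1..n} \<rightarrow> carrier R"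
  shows "cyclic_matrices R n I s1 (\<lambda>s. if s = s1 then companion R n u else mat_comb R n (companion R n u) (a s))"
proof -
  let ?C = "companion R n u"
  have C: "?C \<in> mats R n"
    using u by (rule companion_closed)
  have C_comb: "mat_op R n ?C (mat_op R n (mat_comb R n ?C (a s)) v) = mat_op R n (mat_comb R n ?C (a s)) (mat_op R n ?C v)"
    if "s \<in> I - {s1}" "v \<in> vecs R n" for s v
    using C a[OF that(1)] C refl that(2) by (rule mat_comb_commute)
  have comb_comb: "mat_op R n (mat_comb R n ?C (a t)) (mat_op R n (mat_comb R n ?C (a s)) v)
      = mat_op R n (mat_comb R n ?C (a s)) (mat_op R n (mat_comb R n ?C (a t)) v)"
    if "s \<in> I - {s1}" "t \<in> I - {s1}" "v \<in> vecs R n" for s t v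
    using C a[OF that(1)] mat_comb_closed[OF C a[OF that(2)]] C_comb[OF that(2), symmetric] that(3)
    by (rule mat_comb_commute)
  show ?thesis
  proof (intro cyclic_matrices.intro cyclic_matrices_axioms.intro cring_axioms n s1)
    fix s t v assume "s \<in> I" "t \<in> I" "v \<in> vecs R n"
    then show "mat_op R n (if s = s1 then ?C else mat_comb R n ?C (a s))
        (mat_op R n (if t = s1 then ?C else mat_comb R n ?C (a t)) v)
      = mat_op R n (if t = s1 then ?C else mat_comb R n ?C (a t))
        (mat_op R n (if s = s1 then ?C else mat_comb R n ?C (a s)) v)"
      using C_comb comb_comb by auto
  next
    fix k assume "k \<in> {1..n}"
    then show "(mat_op R n (if s1 = s1 then ?C else mat_comb R n ?C (a s1)) ^^ (k - 1)) (unit_vec R n 1)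
      = unit_vec R n k"
      using companion_pow_unit_vec[OF u, of "k - 1"] by auto
  qed (auto simp: C mat_comb_closed a)
qed

section \<open>Subrings containing the matrix entries\<close>

lemma subring_finsum:
  assumes "subring D R" "f \<in> K \<rightarrow> D"
  shows "(\<Oplus>k\<in>K. f k) \<in> D"
  using assms(2)
proof (induction K rule: infinite_finite_induct)
  case (insert k K)
  then have "f \<in> K \<rightarrow> carrier R" "f k \<in> carrier R"
    using subringE(1)[OF assms(1)] by auto
  with insert show ?case
    using subringE(7)[OF assms(1)] by (simp add: Pi_iff)
qed (use subringE(2)[OF assms(1)] in simp_all)

lemma mat_op_subring:
  assumes "subring D R" "\<And>i j. i \<in> {1..n} \<Longrightarrow> j \<in> {1..n} \<Longrightarrow> N i j \<in> D"
    and "\<And>i. i \<in> {1..n} \<Longrightarrow> v i \<in> D" "i \<in> {1..n}"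
  shows "mat_op R n N v i \<in> D"
  unfolding mat_op_apply[OF assms(4)]
  using assms subringE(6)[OF assms(1)] by (intro subring_finsum[OF assms(1)]) auto

end

context cyclic_matrices
begin

text \<open>The images of the generic matrices under the retraction agree with the companion model
  at meaningful indices only.\<close>

lemma cyclic_matrices_cong:
  assumes eq: "\<And>s i j. s \<in> I \<Longrightarrow> i \<in> {1..n} \<Longrightarrow> j \<in> {1..n} \<Longrightarrow> N s i j = M s i j"
  shows "cyclic_matrices R n I s1 N"
proof -
  have op: "mat_op R n (N s) v = mat_op R n (M s) v" if "s \<in> I" "v \<in> vecs R n" for s v
    using M[OF that(1)] that(2) eq[OF that(1)] refl by (rule mat_op_cong)
  have pow: "(mat_op R n (N s) ^^ k) v = (mat_op R n (M s) ^^ k) v" if "s \<in> I" "v \<in> vecs R n" for s v k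
    by (induction k) (simp_all add: op that mat_op_pow_closed M)
  show ?thesis
  proof (intro cyclic_matrices.intro cyclic_matrices_axioms.intro cring_axioms n s1)
    show "N s \<in> mats R n" if "s \<in> I" for s
      using M[OF that] eq[OF that] by (simp add: mats_def)
    show "mat_op R n (N s) (mat_op R n (N t) v) = mat_op R n (N t) (mat_op R n (N s) v)"
      if "s \<in> I" "t \<in> I" "v \<in> vecs R n" for s t v
      using that by (simp add: op mat_op_closed M commute)
    show "(mat_op R n (N s1) ^^ (k - 1)) (unit_vec R n 1) = unit_vec R n k" if "k \<in> {1..n}" for k
      using cyclic[OF that] by (simp only: pow[OF s1 unit_vec_closed])
  qed
qed

text \<open>Column \<open>j\<close> of \<open>M s\<close> is the \<open>(j - 1)\<close>-st power of \<open>M s1\<close> applied to column \<open>1\<close>.\<close>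

lemma entries_in_subring:
  assumes D: "subring D R" and last: "\<And>i. i \<in> {1..n} \<Longrightarrow> M s1 i n \<in> D"
    and first: "\<And>s i. s \<in> I - {s1} \<Longrightarrow> i \<in> {1..n} \<Longrightarrow> M s i 1 \<in> D"
    and s: "s \<in> I" and i: "i \<in> {1..n}" and j: "j \<in> {1..n}"
  shows "M s i j \<in> D"
proof -
  have M1: "M s1 i j \<in> D" if i: "i \<in> {1..n}" and j: "j \<in> {1..n}" for i j
  proof (cases "j = n")
    case False
    have "M s1 i j = mat_op R n (M s1) (unit_vec R n j) i"
      using M[OF s1] j i by (rule mat_op_unit_vec[symmetric])
    also have "unit_vec R n j = (mat_op R n (M s1) ^^ (j - 1)) (unit_vec R n 1)"
      using cyclic[OF j] ..
    \<comment> \<open>The exponent is written \<open>Suc j - 1\<close> to match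
      \<open>cyclic\<close> at \<open>Suc j\<close>. For j < n the column is thus a unit vector, and
      its entries 0 and 1 lie in every subring.\<close>
    also have "mat_op R n (M s1) \<dots> = (mat_op R n (M s1) ^^ (Suc j - 1)) (unit_vec R n 1)"
      using j by (cases j) auto
    also have "\<dots> = unit_vec R n (Suc j)"
      using j False by (intro cyclic) auto
    also have "\<dots> i \<in> D"
      using i subringE(2,3)[OF D] by (auto simp: unit_vec_def basis_vec_def)
    finally show ?thesis .
  qed (use last i in auto)
  show ?thesis
  proof (cases "s = s1")
    case False
    have pow: "i \<in> {1..n} \<Longrightarrow> (mat_op R n (M s1) ^^ k) (mat_op R n (M s) (unit_vec R n 1)) i \<in> D" for k i
    proof (induction k arbitrary: i)
      case 0
      then have "mat_op R n (M s) (unit_vec R n 1) i = M s i 1"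
        using s n by (intro mat_op_unit_vec M) auto
      with 0 show ?case
        using first[of s i] s False by simp
    next
      case (Suc k)
      then show ?case
        using mat_op_subring[OF D M1] by simp
    qed
    have "M s i j = mat_op R n (M s) (unit_vec R n j) i"
      using M[OF s] j i by (rule mat_op_unit_vec[symmetric])
    also have "\<dots> = mat_op R n (M s) ((mat_op R n (M s1) ^^ (j - 1)) (unit_vec R n 1)) i"
      unfolding cyclic[OF j] ..
    also have "\<dots> = (mat_op R n (M s1) ^^ (j - 1)) (mat_op R n (M s) (unit_vec R n 1)) i"
      by (subst mat_op_pow_commute[OF M[OF s1] unit_vec_closed commute[OF s s1]]) auto
    finally show ?thesis
      using pow[OF i] by simp
  qed (use M1 i j in auto)
qed

end

section \<open>The representing ring\<close>

text \<open>A homomorphism maps each relation to the same expression in the image matrices, and the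
  vanishing of these differences says that the operators commute and that T_1 is cyclic. Left to
  right it serves the quotient map, right to left the retraction.\<close>

lemma universal_relations_iff:
  fixes A :: "('a, 'm) ring_scheme" and S :: "'s set"
  assumes "ring_hom_cring (U_ring A n S) B \<phi>" "cring A" "1 \<le> n" "s1 \<in> S"
  shows "(\<forall>r \<in> commutator_relations A n S \<union> basis_relations A n S s1. \<phi> r = \<zero>\<^bsub>B\<^esub>)
    \<longleftrightarrow> cyclic_matrices B n S s1 (\<lambda>s i j. \<phi> (U_mat A s i j))"
    (is "?rel \<longleftrightarrow> ?cyc")
proof -
  let ?U = "U_ring A n S"
  interpret h: ring_hom_cring ?U B \<phi> by fact
  interpret A: cring A by fact
  have mats: "U_mat A s \<in> mats ?U n" if "s \<in> S" for s
    using that by (auto simp: mats_def U_mat_def U_ring_def intro: A.indexed_var_in_carrier)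
  let ?M = "\<lambda>s i j. \<phi> (U_mat A s i j)"
  note hmats = h.mats_hom[OF mats]
  have E1: "\<phi> (mat_mult ?U n (U_mat A s) (U_mat A t) i j \<ominus>\<^bsub>?U\<^esub> mat_mult ?U n (U_mat A t) (U_mat A s) i j)
      = mat_mult B n (?M s) (?M t) i j \<ominus>\<^bsub>B\<^esub> mat_mult B n (?M t) (?M s) i j"
    if st: "s \<in> S" "t \<in> S" and ij: "i \<in> {1..n}" "j \<in> {1..n}" for s t i j
    using matsD[OF h.R.mat_mult_closed[OF mats[OF st(1)] mats[OF st(2)]] ij]
      matsD[OF h.R.mat_mult_closed[OF mats[OF st(2)] mats[OF st(1)]] ij]
    by (simp add: a_minus_def h.mat_mult_hom[OF mats mats ij] st)
  \<comment> \<open>Exponent and index are kept independent here; they are used as k - 1 and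
    k.\<close>
  have E2: "\<phi> (mat_act ?U n (mat_pow ?U n (U_mat A s1) k) (basis_vec ?U 1) i \<ominus>\<^bsub>?U\<^esub> basis_vec ?U l i)
      = (mat_op B n (?M s1) ^^ k) (unit_vec B n 1) i \<ominus>\<^bsub>B\<^esub> unit_vec B n l i"
    if i: "i \<in> {1..n}" and l: "l \<in> {1..n}" for k l i
  proof -
    note P = h.R.mat_pow_closed[OF mats[OF \<open>s1 \<in> S\<close>], of k]
    have "1 \<in> {1..n}"
      using \<open>1 \<le> n\<close> by simp
    then have "mat_act ?U n (mat_pow ?U n (U_mat A s1) k) (basis_vec ?U 1) i
        = mat_op ?U n (mat_pow ?U n (U_mat A s1) k) (unit_vec ?U n 1) i"
      using i P by (simp only: h.R.mat_act_basis_vec h.R.mat_op_unit_vec)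
    also have "\<dots> = (mat_op ?U n (U_mat A s1) ^^ k) (unit_vec ?U n 1) i"
      by (simp only: h.R.mat_op_pow[OF mats[OF \<open>s1 \<in> S\<close>] h.R.unit_vec_closed])
    finally have 1: "mat_act ?U n (mat_pow ?U n (U_mat A s1) k) (basis_vec ?U 1) i
        = (mat_op ?U n (U_mat A s1) ^^ k) (unit_vec ?U n 1) i" .
    have "\<phi> ((mat_op ?U n (U_mat A s1) ^^ k) (unit_vec ?U n 1) i)
        = (mat_op B n (?M s1) ^^ k) (unit_vec B n 1) i"
      using fun_cong[OF h.mat_op_pow_hom[OF mats[OF \<open>s1 \<in> S\<close>] h.R.unit_vec_closed, of k 1], of i] i
      by (simp add: h.unit_vec_hom)
    moreover have "(mat_op ?U n (U_mat A s1) ^^ k) (unit_vec ?U n 1) i \<in> carrier ?U"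
      using h.R.mat_op_pow_closed[OF mats[OF \<open>s1 \<in> S\<close>] h.R.unit_vec_closed] i by (rule vecsD)
    moreover have "basis_vec ?U l i \<in> carrier ?U" "\<phi> (basis_vec ?U l i) = unit_vec B n l i"
      using i by (auto simp: basis_vec_def unit_vec_def)
    ultimately show ?thesis
      unfolding 1 by (simp add: a_minus_def)
  qed
  show ?thesis
  proof
    assume rel: ?rel
    show ?cyc
    proof (intro cyclic_matrices.intro cyclic_matrices_axioms.intro h.S.cring_axioms assms hmats)
      fix s t v assume st: "s \<in> S" "t \<in> S" and v: "v \<in> vecs B n"
      show "mat_op B n (?M s) (mat_op B n (?M t) v) = mat_op B n (?M t) (mat_op B n (?M s) v)"
      proof (rule h.S.mat_op_commute[OF hmats[OF st(1)] hmats[OF st(2)] v])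
        fix i j assume ij: "i \<in> {1..n}" "j \<in> {1..n}"
        then have "mat_mult B n (?M s) (?M t) i j \<ominus>\<^bsub>B\<^esub> mat_mult B n (?M t) (?M s) i j = \<zero>\<^bsub>B\<^esub>"
          unfolding E1[OF st ij, symmetric] using rel st
          by (intro bspec[OF rel]) (auto simp: commutator_relations_def)
        then show "mat_mult B n (?M s) (?M t) i j = mat_mult B n (?M t) (?M s) i j"
          using matsD[OF h.S.mat_mult_closed ij] hmats st by (simp add: h.S.r_right_minus_eq)
      qed
    next
      fix k assume k: "k \<in> {1..n}"
      show "(mat_op B n (?M s1) ^^ (k - 1)) (unit_vec B n 1) = unit_vec B n k"
      proof (rule vecs_eqI)
        show c: "(mat_op B n (?M s1) ^^ (k - 1)) (unit_vec B n 1) \<in> vecs B n"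
          using hmats[OF \<open>s1 \<in> S\<close>] h.S.unit_vec_closed by (rule h.S.mat_op_pow_closed)
        fix i assume i: "i \<in> {1..n}"
        then have "(mat_op B n (?M s1) ^^ (k - 1)) (unit_vec B n 1) i \<ominus>\<^bsub>B\<^esub> unit_vec B n k i = \<zero>\<^bsub>B\<^esub>"
          unfolding E2[OF i k, symmetric] using k
          by (intro bspec[OF rel]) (auto simp: basis_relations_def)
        then show "(mat_op B n (?M s1) ^^ (k - 1)) (unit_vec B n 1) i = unit_vec B n k i"
          using vecsD[OF c i] vecsD[OF h.S.unit_vec_closed i] by (simp add: h.S.r_right_minus_eq)
      qed (rule h.S.unit_vec_closed)
    qed
  next
    assume ?cyc
    then interpret c: cyclic_matrices B n S s1 ?M .
    show ?rel
    proof
      fix r assume "r \<in> commutator_relations A n S \<union> basis_relations A n S s1"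
      then consider
        (comm) s t i j where "s \<in> S" "t \<in> S" "i \<in> {1..n}" "j \<in> {1..n}"
          "r = mat_mult ?U n (U_mat A s) (U_mat A t) i j \<ominus>\<^bsub>?U\<^esub> mat_mult ?U n (U_mat A t) (U_mat A s) i j"
        | (basis) k i where "k \<in> {1..n}" "i \<in> {1..n}"
          "r = mat_act ?U n (mat_pow ?U n (U_mat A s1) (k - 1)) (basis_vec ?U 1) i \<ominus>\<^bsub>?U\<^esub> basis_vec ?U k i"
        unfolding commutator_relations_def basis_relations_def by blast
      then show "\<phi> r = \<zero>\<^bsub>B\<^esub>"
      proof cases
        case comm
        \<comment> \<open>Column j of a product is the composite operator applied to T_j, so
          commuting operators give equal entries.\<close>
        have "mat_mult B n (?M s) (?M t) i j = mat_mult B n (?M t) (?M s) i j"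
          using comm(1-4)
          by (simp only: h.S.mat_mult_eq_mat_op[OF hmats hmats] c.commute h.S.unit_vec_closed)
        then show ?thesis
          unfolding comm(5) E1[OF comm(1-4)]
          using matsD[OF h.S.mat_mult_closed[OF hmats hmats] comm(3,4)] comm by (simp add: a_minus_def h.S.r_neg)
      next
        case basis
        show ?thesis
          unfolding basis(3) E2[OF basis(2,1)] c.cyclic[OF basis(1)]
          using vecsD[OF h.S.unit_vec_closed basis(2)] by (simp add: a_minus_def h.S.r_neg)
      qed
    qed
  qed
qed

lemma indexed_poly_ring_mono:
  assumes "ring A" "V \<subseteq> V'"
  shows "carrier (indexed_poly_ring A V) \<subseteq> carrier (indexed_poly_ring A V')"
proof
  interpret ring A by fact
  fix p assume "p \<in> carrier (indexed_poly_ring A V)"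
  then have "p \<in> indexed_pset V (carrier A)"
    by (simp add: indexed_poly_ring_simps)
  then have "p \<in> indexed_pset V' (carrier A)"
    by induction (use assms(2) in \<open>auto intro: indexed_pset.intros\<close>)
  then show "p \<in> carrier (indexed_poly_ring A V')"
    by (simp add: indexed_poly_ring_simps)
qed

text \<open>The operations of \<open>indexed_poly_ring\<close> do not depend on the set of
  variables; only the carrier shrinks.\<close>

lemma ring_hom_indexed_poly_subset:
  assumes "ring A" "h \<in> ring_hom (indexed_poly_ring A V') B" "V \<subseteq> V'"
  shows "h \<in> ring_hom (indexed_poly_ring A V) B"
  using indexed_poly_ring_mono[OF assms(1,3)] assms(2)
  by (auto simp: ring_hom_def ring.indexed_poly_ring_simps[OF assms(1)] Pi_iff subset_iff)

section \<open>The quotient by the relations and its listed variables\<close>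

locale generic_matrices = cring A for A :: "('a, 'm) ring_scheme" (structure) +
  fixes n :: nat and S :: "'s set" and s1 :: 's
  assumes n: "1 \<le> n" and s1: "s1 \<in> S"
begin

abbreviation "U \<equiv> U_ring A n S"
abbreviation "H \<equiv> H_ring A n S s1"

definition V :: "('s \<times> nat \<times> nat) set"
  where "V = {(s1, i, n) | i. i \<in> {1..n}} \<union> {(s, i, 1) | s i. s \<in> S - {s1} \<and> i \<in> {1..n}}"

abbreviation "P \<equiv> indexed_poly_ring A V"

sublocale U: cring U
  unfolding U_ring_def by (rule cring_indexed_poly_ring)

sublocale P: cring P
  by (rule cring_indexed_poly_ring)

lemma V_subset: "V \<subseteq> S \<times> {1..n} \<times> {1..n}"
  using n s1 by (auto simp: V_def)

lemma P_subset_U: "carrier P \<subseteq> carrier U"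
  unfolding U_ring_def using ring_axioms V_subset by (rule indexed_poly_ring_mono)

lemma U_mat_closed: "s \<in> S \<Longrightarrow> U_mat A s \<in> mats U n"
  by (auto simp: mats_def U_mat_def U_ring_def intro: indexed_var_in_carrier)

lemma relations_closed: "commutator_relations A n S \<union> basis_relations A n S s1 \<subseteq> carrier U"
proof
  fix r assume "r \<in> commutator_relations A n S \<union> basis_relations A n S s1"
  then consider
    (comm) s t i j where "s \<in> S" "t \<in> S" "i \<in> {1..n}" "j \<in> {1..n}"
      "r = mat_mult U n (U_mat A s) (U_mat A t) i j \<ominus>\<^bsub>U\<^esub> mat_mult U n (U_mat A t) (U_mat A s) i j"
    | (basis) k i where "k \<in> {1..n}" "i \<in> {1..n}"
      "r = mat_act U n (mat_pow U n (U_mat A s1) (k - 1)) (basis_vec U 1) i \<ominus>\<^bsub>U\<^esub> basis_vec U k i"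
    unfolding commutator_relations_def basis_relations_def by blast
  then show "r \<in> carrier U"
  proof cases
    case comm
    then show ?thesis
      using matsD[OF U.mat_mult_closed[OF U_mat_closed U_mat_closed]] by simp
  next
    case basis
    have "1 \<in> {1..n}"
      using n by simp
    then have "mat_act U n (mat_pow U n (U_mat A s1) (k - 1)) (basis_vec U 1) i \<in> carrier U"
      using matsD[OF U.mat_pow_closed[OF U_mat_closed[OF s1]] basis(2)] basis(2)
      by (simp only: U.mat_act_basis_vec[OF U.mat_pow_closed[OF U_mat_closed[OF s1]]])
    moreover have "basis_vec U k i \<in> carrier U"
      by (simp add: basis_vec_def)
    ultimately show ?thesis
      unfolding basis(3) by (rule U.minus_closed)
  qed
qed

lemma ideal_H_ideal: "ideal (H_ideal A n S s1) U"
  unfolding H_ideal_def by (rule U.genideal_ideal[OF relations_closed])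

lemma H_class_hom: "ring_hom_cring U H (H_class A n S s1)"
  using ideal.rcos_ring_hom_cring[OF ideal_H_ideal U.cring_axioms]
  unfolding H_ring_def H_class_def by (simp add: eta_contract_eq)

lemma H_class_eq_iff:
  assumes "p \<in> carrier U" "q \<in> carrier U"
  shows "H_class A n S s1 p = H_class A n S s1 q \<longleftrightarrow> p \<ominus>\<^bsub>U\<^esub> q \<in> H_ideal A n S s1"
  using U.quotient_eq_iff_same_a_r_cos[OF ideal_H_ideal assms] by (simp add: H_class_def)

lemma H_carrier: "carrier H = H_class A n S s1 ` carrier U"
  by (auto simp: H_ring_def FactRing_def A_RCOSETS_def' H_class_def)

lemma cyclic_matrices_H: "cyclic_matrices H n S s1 (H_mat A n S s1)"
proof -
  interpret h: ring_hom_cring U H "H_class A n S s1"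
    by (rule H_class_hom)
  have "H_class A n S s1 r = \<zero>\<^bsub>H\<^esub>"
    if "r \<in> commutator_relations A n S \<union> basis_relations A n S s1" for r
  proof -
    have r: "r \<in> carrier U" "r \<in> H_ideal A n S s1"
      using that relations_closed U.genideal_self[OF relations_closed] by (auto simp: H_ideal_def)
    then have "H_class A n S s1 r = H_class A n S s1 \<zero>\<^bsub>U\<^esub>"
      by (subst H_class_eq_iff) (auto simp: a_minus_def)
    then show ?thesis
      by simp
  qed
  then have "cyclic_matrices H n S s1 (\<lambda>s i j. H_class A n S s1 (U_mat A s i j))"
    using universal_relations_iff[OF H_class_hom cring_axioms n s1] by blast
  then show ?thesis
    unfolding H_mat_def .
qed

lemma H_class_hom_P: "ring_hom_cring P H (H_class A n S s1)"
proof -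
  interpret h: ring_hom_cring U H "H_class A n S s1"
    by (rule H_class_hom)
  show ?thesis
    using ring_hom_indexed_poly_subset[OF ring_axioms h.homh[unfolded U_ring_def] V_subset]
    by (intro ring_hom_cring.intro ring_hom_cring_axioms.intro P.cring_axioms h.S.cring_axioms)
qed

text \<open>The image of P is a subring containing column n of the matrix for s1 and column 1 of the
  others. By \<open>entries_in_subring\<close> it contains the classes of all variables, and
  induction on polynomials does the rest.\<close>

lemma H_class_surj: "H_class A n S s1 ` carrier P = carrier H"
proof
  interpret h: ring_hom_cring P H "H_class A n S s1"
    by (rule H_class_hom_P)
  interpret hU: ring_hom_cring U H "H_class A n S s1"
    by (rule H_class_hom)
  interpret c: cyclic_matrices H n S s1 "H_mat A n S s1"
    by (rule cyclic_matrices_H)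
  let ?D = "H_class A n S s1 ` carrier P"
  show "?D \<subseteq> carrier H"
    by (rule image_subsetI) (rule h.hom_closed)
  have D: "subring ?D H"
    using h.ring.img_is_subring[OF P.carrier_is_subring] .
  have var: "H_class A n S s1 (indexed_var v) \<in> ?D" if "v \<in> V" for v
    using indexed_var_in_carrier[OF that] by (rule imageI)
  have "H_mat A n S s1 s i j \<in> ?D" if "s \<in> S" "i \<in> {1..n}" "j \<in> {1..n}" for s i j
  proof (rule c.entries_in_subring[OF D _ _ that])
    show "H_mat A n S s1 s1 i n \<in> ?D" if "i \<in> {1..n}" for i
      unfolding H_mat_def U_mat_def using that by (intro var) (simp add: V_def)
    show "H_mat A n S s1 s i 1 \<in> ?D" if "s \<in> S - {s1}" "i \<in> {1..n}" for s i
      unfolding H_mat_def U_mat_def using that by (intro var) (simp add: V_def)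
  qed
  then have entries: "H_class A n S s1 (indexed_var v) \<in> ?D" if "v \<in> S \<times> {1..n} \<times> {1..n}" for v
    using that unfolding H_mat_def U_mat_def by (cases v) blast
  show "carrier H \<subseteq> ?D"
  proof -
    have "H_class A n S s1 p \<in> ?D" if "p \<in> carrier U" for p
      using that[unfolded U_ring_def]
    proof (induction p rule: indexed_poly_induct)
      case (const k)
      then have "indexed_const k \<in> carrier P"
        by (simp add: indexed_poly_ring_simps indexed_pset.indexed_const)
      then show ?case
        by (rule imageI)
    next
      case (add p q)
      then show ?case
        using subringE(7)[OF D] hU.hom_add[of p q] by (simp add: U_ring_def)
    next
      case (mult p v)
      then show ?case
        using subringE(6)[OF D _ entries] hU.hom_mult[of p "indexed_var v"]
        by (simp add: U_ring_def indexed_var_in_carrier)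
    qed
    then show ?thesis
      unfolding H_carrier by blast
  qed
qed

text \<open>Each variable of A[U] is sent to the corresponding entry of the companion model over P.
  That model is a cyclic family, so the relations go to zero.\<close>

lemma retraction_exists:
  obtains \<rho> where "ring_hom_cring U P \<rho>"
    and "\<And>r. r \<in> H_ideal A n S s1 \<Longrightarrow> \<rho> r = \<zero>\<^bsub>P\<^esub>" and "\<And>p. p \<in> carrier P \<Longrightarrow> \<rho> p = p"
proof -
  interpret C: ring_hom_cring A P indexed_const
    by (rule const_ring_hom)
  \<comment> \<open>The parameters of the model are the listed variables themselves, which reappear
    as column n of the companion matrix and as the first columns of the polynomials in it.\<close>
  define u where "u i = indexed_var (s1, i, n)" for i :: nat
  define a where "a s i = indexed_var (s, i, 1 :: nat)" for s :: 's and i :: nat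
  define N where "N = (\<lambda>s. if s = s1 then companion P n u else mat_comb P n (companion P n u) (a s))"
  have u: "u \<in> {1..n} \<rightarrow> carrier P"
    unfolding u_def by (intro funcsetI indexed_var_in_carrier) (simp add: V_def)
  have a: "a s \<in> {1..n} \<rightarrow> carrier P" if "s \<in> S - {s1}" for s
    unfolding a_def using that by (intro funcsetI indexed_var_in_carrier) (simp add: V_def)
  have "cyclic_matrices P n S s1 N"
    unfolding N_def using n s1 u a by (rule P.cyclic_matrices_companion)
  then interpret c: cyclic_matrices P n S s1 N .
  have "(\<lambda>(s, i, j). N s i j) \<in> S \<times> {1..n} \<times> {1..n} \<rightarrow> carrier P"
    using matsD[OF c.M] by auto
  then obtain \<rho> where \<rho>: "ring_hom_cring (indexed_poly_ring A (S \<times> {1..n} \<times> {1..n})) P \<rho>"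
    and \<rho>_const: "\<And>k. k \<in> carrier A \<Longrightarrow> \<rho> (indexed_const k) = indexed_const k"
    and \<rho>_var: "\<And>v. v \<in> S \<times> {1..n} \<times> {1..n} \<Longrightarrow> \<rho> (indexed_var v) = (\<lambda>(s, i, j). N s i j) v"
    by (rule C.indexed_poly_eval_exists) (rule that)
  have \<rho>U: "ring_hom_cring U P \<rho>"
    unfolding U_ring_def by (rule \<rho>)
  interpret r: ring_hom_cring U P \<rho>
    by (rule \<rho>U)
  have \<rho>_mat: "\<rho> (U_mat A s i j) = N s i j" if "s \<in> S" "i \<in> {1..n}" "j \<in> {1..n}" for s i j
    using that by (simp add: U_mat_def \<rho>_var)
  have "cyclic_matrices P n S s1 (\<lambda>s i j. \<rho> (U_mat A s i j))"
    using \<rho>_mat by (rule c.cyclic_matrices_cong)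
  then have "\<forall>r \<in> commutator_relations A n S \<union> basis_relations A n S s1. \<rho> r = \<zero>\<^bsub>P\<^esub>"
    unfolding universal_relations_iff[OF \<rho>U cring_axioms n s1] .
  then have rel: "commutator_relations A n S \<union> basis_relations A n S s1 \<subseteq> a_kernel U P \<rho>"
    using relations_closed unfolding a_kernel_def' by blast
  have ker: "H_ideal A n S s1 \<subseteq> a_kernel U P \<rho>"
    unfolding H_ideal_def using r.ring.kernel_is_ideal rel by (rule U.genideal_minimal)
  have var: "\<rho> (indexed_var v) = indexed_var v" if "v \<in> V" for v
    using that unfolding V_def
  proof (elim UnE CollectE exE conjE)
    fix i assume "v = (s1, i, n)" "i \<in> {1..n}"
    then show ?thesis
      using n s1 by (auto simp: \<rho>_var N_def companion_def u_def)
  next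
    fix s i assume "v = (s, i, 1)" "s \<in> S - {s1}" "i \<in> {1..n}"
    then show ?thesis
      using n by (auto simp: \<rho>_var N_def P.mat_comb_companion_column u a a_def)
  qed
  have "\<rho> p = p" if "p \<in> carrier P" for p
    using that
  proof (induction p rule: indexed_poly_induct)
    case (const k)
    then show ?case by (rule \<rho>_const)
  next
    case (add p q)
    then show ?case
      using P_subset_U r.hom_add[of p q] by (auto simp: U_ring_def indexed_poly_ring_simps)
  next
    case (mult p v)
    have "indexed_var v \<in> carrier P"
      using mult by (intro indexed_var_in_carrier)
    then show ?case
      using mult var[OF mult(2)] P_subset_U r.hom_mult[of p "indexed_var v"]
      by (auto simp: U_ring_def indexed_poly_ring_simps)
  qed
  moreover have "\<rho> r = \<zero>\<^bsub>P\<^esub>" if "r \<in> H_ideal A n S s1" for r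
    using ker that unfolding a_kernel_def' by blast
  ultimately show thesis
    using \<rho>U by (intro that)
qed

text \<open>For injectivity, two elements of P with the same class differ by an element of the
  ideal; the retraction kills this difference but fixes both elements.\<close>

theorem H_class_iso: "H_class A n S s1 \<in> ring_iso P H"
proof -
  interpret h: ring_hom_cring P H "H_class A n S s1"
    by (rule H_class_hom_P)
  obtain \<rho> where \<rho>: "ring_hom_cring U P \<rho>"
    and ker: "\<And>r. r \<in> H_ideal A n S s1 \<Longrightarrow> \<rho> r = \<zero>\<^bsub>P\<^esub>" and id: "\<And>p. p \<in> carrier P \<Longrightarrow> \<rho> p = p"
    by (rule retraction_exists) (rule that)
  interpret r: ring_hom_cring U P \<rho>
    by (rule \<rho>)
  have "inj_on (H_class A n S s1) (carrier P)"
  proof (rule inj_onI)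
    fix p q assume pq: "p \<in> carrier P" "q \<in> carrier P" "H_class A n S s1 p = H_class A n S s1 q"
    then have U: "p \<in> carrier U" "q \<in> carrier U"
      using P_subset_U by auto
    then have "\<rho> (p \<ominus>\<^bsub>U\<^esub> q) = \<zero>\<^bsub>P\<^esub>"
      using pq H_class_eq_iff ker by blast
    then have "p \<ominus>\<^bsub>P\<^esub> q = \<zero>\<^bsub>P\<^esub>"
      using U pq by (simp add: a_minus_def id)
    then show "p = q"
      using pq P.r_right_minus_eq by simp
  qed
  then show ?thesis
    using h.homh H_class_surj by (simp add: ring_iso_def bij_betw_def)
qed

text \<open>For the matrices of classes over H, the ring W is \<open>HY_ring\<close>, evaluation at
  T_1 is \<open>universal_hom\<close>, and the column polynomials are \<open>Y_comb\<close> of the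
  columns, so \<open>ann_eq_genideal\<close> applies.\<close>

theorem universal_family_eq:
  "universal_family A n S s1 =
     Idl\<^bsub>HY_ring A n S s1\<^esub>
       ({(Y_var A n S s1 s1 [^]\<^bsub>HY_ring A n S s1\<^esub> n)
           \<ominus>\<^bsub>HY_ring A n S s1\<^esub> column_poly A n S s1 s1 n}
        \<union> {Y_var A n S s1 s \<ominus>\<^bsub>HY_ring A n S s1\<^esub> column_poly A n S s1 s 1
            | s. s \<in> S - {s1}})"
proof -
  interpret c: cyclic_matrices H n S s1 "H_mat A n S s1"
    by (rule cyclic_matrices_H)
  have column: "column_poly A n S s1 s j = c.Y_comb (\<lambda>i. H_mat A n S s1 s i j)" for s j
    by (simp add: column_poly_def c.Y_comb_def HY_ring_def Y_var_def)
  have "universal_family A n S s1 = c.ann"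
    by (auto simp: universal_family_def c.ann_def c.eval_vec_def universal_hom_def HY_ring_def)
  then show ?thesis
    by (simp add: c.ann_eq_genideal c.ann_gens_def column HY_ring_def Y_var_def)
qed

end

theorem proposition7p3:
  fixes A :: "('a, 'm) ring_scheme" and n :: nat and S :: "'s set" and s1 :: 's
  assumes "cring A" and "n \<ge> 1" and "s1 \<in> S"
  shows "H_class A n S s1
           \<in> ring_iso
               (indexed_poly_ring A
                 ({(s1, i, n) | i. i \<in> {1..n}} \<union> {(s, i, 1) | s i. s \<in> S - {s1} \<and> i \<in> {1..n}}))
               (H_ring A n S s1)
       \<and> universal_family A n S s1 =
           Idl\<^bsub>HY_ring A n S s1\<^esub>
             ({(Y_var A n S s1 s1 [^]\<^bsub>HY_ring A n S s1\<^esub> n)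
                 \<ominus>\<^bsub>HY_ring A n S s1\<^esub> column_poly A n S s1 s1 n}
              \<union> {Y_var A n S s1 s \<ominus>\<^bsub>HY_ring A n S s1\<^esub> column_poly A n S s1 s 1
                  | s. s \<in> S - {s1}})"
proof -
  interpret generic_matrices A n S s1
    using assms by (intro generic_matrices.intro generic_matrices_axioms.intro)
  show ?thesis
    using H_class_iso[unfolded V_def] universal_family_eq by (rule conjI)
qed

end
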